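(* Let $\xi$ denote Riemann's xi function. If $H=\{s\in\mathbb{C}:\Re(s)>\sigma_0\}$ is an open right half-plane (for some real $\sigma_0$) containing no zeros of $\xi$, then for every fixed real $t_0$ the function $\sigma\mapsto|\xi(\sigma+it_0)|$ is strictly increasing on $(\sigma_0,\infty)$. Similarly, if $\{s\in\mathbb{C}:\Re(s)<\sigma_0\}$ is an open left half-plane containing no zeros of $\xi$, then for every fixed real $t_0$ the function $\sigma\mapsto|\xi(\sigma+it_0)|$ is strictly decreasing on $(-\infty,\sigma_0)$.
   Context: Riemann's xi function is the entire function defined by $\xi(s)=\frac{1}{2}s(s-1)\pi^{-s/2}\Gamma(s/2)\zeta(s)$, where $\zeta$ is the Riemann zeta function (the analytic continuation of $\sum_{n\ge1}n^{-s}$) and $\Gamma$ is the gamma function. Its zeros are exactly the nonreal zeros of $\zeta$. *)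

theory Defs
  imports "HOL-Complex_Analysis.Complex_Analysis"
begin

(* The unique analytic continuation to the plane without the pole 1; the value at 1 itself is
   a convention, needed only to make the description unique. *)
definition riemann_zeta :: "complex \<Rightarrow> complex" where
  "riemann_zeta = (THE f. f holomorphic_on - {1} \<and>
     (\<forall>s. Re s > 1 \<longrightarrow> (\<lambda>n. 1 / of_nat (Suc n) powr s) sums f s) \<and> f 1 = 0)"

(* The product formula has removable singularities at 1 and at the poles 0, -2, -4, ... of
   Gamma (s / 2), where the HOL values are the conventional ones (Gamma is 0 at its poles);
   remove_sings replaces them by the limits, which gives the entire function. *)
definition riemann_xi :: "complex \<Rightarrow> complex" where
  "riemann_xi = remove_sings (\<lambda>s. 1 / 2 * s * (s - 1) * of_real pi powr (- s / 2)
     * Gamma (s / 2) * riemann_zeta s)"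

end

theory Submission
  imports Defs
    "HOL-Probability.Characteristic_Functions"
    "HOL-Real_Asymp.Real_Asymp"
begin

text \<open>
  The usual argument reads the monotonicity off the Hadamard product of \<open>\<xi>\<close>. Here it is obtained by
  reflection instead. If \<open>\<xi>\<close> has no zeros in \<open>Re s > \<sigma>\<^sub>0\<close> and \<open>\<sigma>\<^sub>0 < \<sigma>\<^sub>1 < \<sigma>\<^sub>2\<close>, put
  \<open>a = (\<sigma>\<^sub>1 + \<sigma>\<^sub>2) / 2\<close>, \<open>c = 2 a - 1\<close> and \<open>Q s = \<xi> (s - c) / \<xi> s\<close>. By the functional equation,
  \<open>\<bar>Q\<bar>\<close> compares the values of \<open>\<bar>\<xi>\<bar>\<close> at \<open>s\<close> and at its mirror image in the line \<open>Re s = a\<close>; in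
  particular \<open>\<bar>Q\<bar> = 1\<close> on that line. Since \<open>\<xi>\<close> has a zero (an even zero-free entire function of order
  less than 2 is constant), \<open>\<sigma>\<^sub>0 \<ge> 1/2\<close> and so \<open>c > 0\<close>; hence the Gamma factor makes \<open>\<bar>Q\<bar> \<le> 1/2\<close> on
  vertical lines arbitrarily far to the right. In the strip between \<open>Re s = a\<close> and such a line, \<open>Q\<close> is
  at most the exponential of a power of \<open>Im s\<close>, because Borel-Caratheodory bounds \<open>\<xi>\<close> from below;
  so Phragmen-Lindelof and the maximum principle give \<open>\<bar>Q\<bar> < 1\<close> to the right of \<open>a\<close>. The half-plane to the left follows
  by the functional equation.

  The continuation and the functional equation come from the theta transformation, in
  the variable \<open>v\<close> with \<open>x = exp (2 v)\<close>, so that \<open>x \<mapsto> 1/x\<close> becomes \<open>v \<mapsto> - v\<close>.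
\<close>

subsection \<open>The theta transformation\<close>

text \<open>Such an \<open>H\<close> is orthogonal to all polynomials in
  \<open>cos (2 * pi * y)\<close>. These approximate it uniformly, so the integral of its square
  vanishes.\<close>

lemma cosine_series_unique:
  fixes H :: "real \<Rightarrow> real"
  assumes cont: "continuous_on {0..1} H"
    and sym: "\<And>y. y \<in> {0..1} \<Longrightarrow> H (1 - y) = H y"
    and orth: "\<And>k::nat. integral {0..1} (\<lambda>y. H y * cos (2 * pi * k * y)) = 0"
    and y: "y \<in> {0..1}"
  shows "H y = 0"
proof -
  have int: "(\<lambda>y. H y * g y) integrable_on {0..1}" if "continuous_on {0..1} g" for g
    by (intro integrable_continuous_interval continuous_intros cont that)
  have pow: "integral {0..1} (\<lambda>y. H y * (cos (2 * pi * k * y) * cos (2 * pi * y) ^ m)) = 0" for k m :: nat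
  proof (induction m arbitrary: k)
    case 0
    then show ?case using orth by simp
  next
    case (Suc m)
    \<comment> \<open>Another factor \<open>cos (2 * pi * y)\<close> moves the frequency
      \<open>k\<close> up and down by one, hence the general \<open>k\<close> in the induction; at
      \<open>k = 0\<close> both neighbours are \<open>1\<close>, as cosine is even.\<close>
    have "cos (2 * pi * k * y) * cos (2 * pi * y)
       = 1/2 * cos (2 * pi * Suc k * y) + 1/2 * cos (2 * pi * (if k = 0 then 1 else k - 1 :: nat) * y)" for y :: real
    proof (cases k)
      case 0
      then show ?thesis by simp
    next
      case (Suc l)
      have "2 * pi * k * y - 2 * pi * y = 2 * pi * real l * y" "2 * pi * k * y + 2 * pi * y = 2 * pi * Suc k * y"
        by (simp_all add: Suc algebra_simps)
      then show ?thesis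
        unfolding cos_times_cos by (simp add: Suc)
    qed
    moreover have "H y * (a * c ^ Suc m) = 1/2 * (H y * (b * c ^ m)) + 1/2 * (H y * (d * c ^ m))"
      if "a * c = 1/2 * b + 1/2 * d" for a b c d y :: real
    proof -
      have "H y * (a * c ^ Suc m) = H y * ((a * c) * c ^ m)" by simp
      then show ?thesis unfolding that by (simp add: algebra_simps)
    qed
    ultimately have *: "H y * (cos (2 * pi * k * y) * cos (2 * pi * y) ^ Suc m) =
        1/2 * (H y * (cos (2 * pi * Suc k * y) * cos (2 * pi * y) ^ m)) +
        1/2 * (H y * (cos (2 * pi * (if k = 0 then 1 else k - 1 :: nat) * y) * cos (2 * pi * y) ^ m))" for y
      by blast
    have "((\<lambda>y. H y * (cos (2 * pi * k * y) * cos (2 * pi * y) ^ Suc m)) has_integral (1/2 * 0 + 1/2 * 0)) {0..1}"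
    proof (subst *, intro has_integral_add has_integral_mult_right)
      have "((\<lambda>y. H y * (cos (2 * pi * real j * y) * cos (2 * pi * y) ^ m)) has_integral 0) {0..1}" for j
        using integrable_integral[OF int, of "\<lambda>y. cos (2 * pi * real j * y) * cos (2 * pi * y) ^ m"] Suc.IH[of j]
        by (simp add: continuous_intros)
      then show "((\<lambda>y. H y * (cos (2 * pi * Suc k * y) * cos (2 * pi * y) ^ m)) has_integral 0) {0..1}"
        "((\<lambda>y. H y * (cos (2 * pi * (if k = 0 then 1 else k - 1 :: nat) * y) * cos (2 * pi * y) ^ m)) has_integral 0) {0..1}"
        by blast+
    qed
    then show ?case by (simp add: integral_unique)
  qed
  \<comment> \<open>By symmetry \<open>H\<close> factors through \<open>cos (2 * pi * y)\<close>, so the Weierstrass theorem on \<open>{-1..1}\<close> applies.\<close>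
  define h where "h u = H (arccos u / (2 * pi))" for u
  \<comment> \<open>\<open>arccos\<close> undoes the cosine only for \<open>y \<le> 1/2\<close>;
    symmetry gives the rest.\<close>
  have h_cos: "h (cos (2 * pi * y)) = H y" if y: "y \<in> {0..1}" for y
  proof (cases "y \<le> 1/2")
    case True
    then have "arccos (cos (2 * pi * y)) = 2 * pi * y"
      using y by (intro arccos_cos) (auto simp: mult_left_le)
    then show ?thesis by (simp add: h_def)
  next
    case False
    have "cos (2 * pi * y) = cos (2 * pi * (1 - y))"
      by (simp add: algebra_simps cos_diff)
    moreover have "arccos (cos (2 * pi * (1 - y))) = 2 * pi * (1 - y)"
      using y False by (intro arccos_cos) (auto simp: mult_left_le)
    ultimately have "h (cos (2 * pi * y)) = H (1 - y)" by (simp add: h_def)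
    then show ?thesis using sym y by simp
  qed
  have conth: "continuous_on {-1..1} h"
    unfolding h_def
  proof (rule continuous_on_compose2[OF cont])
    show "continuous_on {- 1..1} (\<lambda>u. arccos u / (2 * pi))"
      by (intro continuous_intros) auto
    show "(\<lambda>u. arccos u / (2 * pi)) ` {- 1..1} \<subseteq> {0..1}"
    proof (intro image_subsetI)
      fix u :: real assume "u \<in> {-1..1}"
      then show "arccos u / (2 * pi) \<in> {0..1}"
        using arccos_lbound[of u] arccos_ubound[of u] by auto
    qed
  qed
  obtain M where M: "\<And>y. y \<in> {0..1} \<Longrightarrow> \<bar>H y\<bar> \<le> M"
    using compact_imp_bounded[OF compact_continuous_image[OF cont compact_Icc]]
    unfolding bounded_iff by (metis image_eqI real_norm_def)
  \<comment> \<open>Orthogonality to \<open>p (cos (2 * pi * y))\<close> makes the integral of the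
    square of \<open>H\<close> that of \<open>H\<close> times the approximation error.\<close>
  have small: "integral {0..1} (\<lambda>y. H y * H y) \<le> M * e" if "e > 0" for e
  proof -
    obtain p where p: "real_polynomial_function p" "\<And>u. u \<in> {-1..1} \<Longrightarrow> \<bar>h u - p u\<bar> < e"
      using Stone_Weierstrass_real_polynomial_function[OF compact_Icc conth \<open>e > 0\<close>] by blast
    obtain a n where an: "p = (\<lambda>x. \<Sum>i\<le>n. a i * x ^ i)"
      using p(1) unfolding real_polynomial_function_iff_sum by blast
    have z: "integral {0..1} (\<lambda>y. H y * p (cos (2 * pi * y))) = 0"
    proof -
      have "integral {0..1} (\<lambda>y. H y * p (cos (2 * pi * y)))
         = integral {0..1} (\<lambda>y. \<Sum>i\<le>n. a i * (H y * (cos (2 * pi * (0::nat) * y) * cos (2 * pi * y) ^ i)))"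
        unfolding an by (simp add: sum_distrib_left mult_ac)
      also have "\<dots> = (\<Sum>i\<le>n. integral {0..1} (\<lambda>y. a i * (H y * (cos (2 * pi * (0::nat) * y) * cos (2 * pi * y) ^ i))))"
        by (intro integral_sum integrable_on_mult_right int continuous_intros) auto
      also have "\<dots> = 0"
        unfolding integral_mult_right pow by simp
      finally show ?thesis .
    qed
    have pc: "continuous_on {0..1} (\<lambda>y. p (cos (2 * pi * y)))"
      unfolding an by (intro continuous_intros)
    have "integral {0..1} (\<lambda>y. H y * H y) = integral {0..1} (\<lambda>y. H y * H y - H y * p (cos (2 * pi * y)))"
      by (subst integral_diff) (auto intro!: int cont pc simp: z)
    also have "\<dots> \<le> integral {0..1} (\<lambda>y::real. M * e)"
    proof (rule integral_le)
      show "(\<lambda>y. H y * H y - H y * p (cos (2 * pi * y))) integrable_on {0..1}"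
        by (intro integrable_diff int cont pc)
      fix y :: real assume y: "y \<in> {0..1}"
      have "\<bar>H y * (H y - p (cos (2 * pi * y)))\<bar> \<le> M * e"
        unfolding abs_mult using M[OF y] p(2)[of "cos (2 * pi * y)"] h_cos[OF y]
        by (intro mult_mono) auto
      then show "H y * H y - H y * p (cos (2 * pi * y)) \<le> M * e"
        by (simp add: algebra_simps)
    qed auto
    finally show ?thesis by simp
  qed
  have M0: "M \<ge> 0" using M[OF y] by linarith
  have "integral {0..1} (\<lambda>y. H y * H y) \<le> 0"
  proof (rule field_le_epsilon)
    fix e :: real assume e: "e > 0"
    have "integral {0..1} (\<lambda>y. H y * H y) \<le> M * (e / (M + 1))"
      using small[of "e / (M + 1)"] M0 e by simp
    also have "\<dots> \<le> 0 + e" using M0 e by (simp add: field_simps)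
    finally show "integral {0..1} (\<lambda>y. H y * H y) \<le> 0 + e" .
  qed
  moreover have "integral {0..1} (\<lambda>y. H y * H y) \<ge> 0"
    by (intro integral_nonneg int cont) auto
  ultimately have "integral {0..1} (\<lambda>y. H y * H y) = 0" by linarith
  then have "\<forall>y\<in>{0..1}. H y * H y = 0"
    by (subst (asm) integral_eq_0_iff) (auto intro!: continuous_intros cont)
  then show ?thesis using y by auto
qed

section \<open>Fourier integrals and termwise integration\<close>

lemma integral_cos_2pi: "integral {0..1} (\<lambda>y. cos (2 * pi * of_int m * y)) = (if m = 0 then 1 else 0)"
proof (cases "m = 0")
  case False
  have "((\<lambda>y. cos (2 * pi * of_int m * y)) has_integral
      (sin (2 * pi * of_int m * 1) / (2 * pi * of_int m) - sin (2 * pi * of_int m * 0) / (2 * pi * of_int m))) {0..1}"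
    by (rule fundamental_theorem_of_calculus)
       (use False in \<open>auto intro!: derivative_eq_intros simp flip: has_real_derivative_iff_has_vector_derivative\<close>)
  moreover have "sin (2 * pi * of_int m) = 0"
    using sin_int_2pin[of m] by (simp add: mult_ac)
  ultimately show ?thesis using False by (auto dest: integral_unique)
qed auto

text \<open>The Gaussian transform is read off the characteristic function of the standard normal
  distribution, rescaled by \<open>sqrt (2 * pi * x)\<close>.\<close>

lemma gaussian_cosine_integral:
  fixes x :: real and k :: real
  assumes "x > 0"
  shows "has_bochner_integral lborel (\<lambda>u. exp (- pi * x * u\<^sup>2) * cos (2 * pi * k * u)) (exp (- pi * k\<^sup>2 / x) / sqrt x)"
proof -
  define t where "t = 2 * pi * k / sqrt (2 * pi * x)"
  interpret real_distribution std_normal_distribution by (rule real_dist_normal_dist)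
  have "integrable std_normal_distribution (\<lambda>u. cos (t * u))"
    by (rule integrable_const_bound[where B = 1]) auto
  moreover have "(LINT u|std_normal_distribution. cos (t * u)) = exp (- (t\<^sup>2) / 2)"
  proof -
    have "(LINT u|std_normal_distribution. cos (t * u)) = Re (char std_normal_distribution t)"
      unfolding char_def using integrable_iexp[of "\<lambda>u. of_real (t * u)"]
      by (subst integral_Re [symmetric]) (auto simp: Re_exp)
    also have "\<dots> = exp (- (t\<^sup>2) / 2)"
      by (simp add: char_std_normal_distribution)
    finally show ?thesis .
  qed
  ultimately have "has_bochner_integral std_normal_distribution (\<lambda>u. cos (t * u)) (exp (- (t\<^sup>2) / 2))"
    by (simp add: has_bochner_integral_iff)
  then have "has_bochner_integral lborel (\<lambda>u. std_normal_density u * cos (t * u)) (exp (- (t\<^sup>2) / 2))"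
    by (simp add: has_bochner_integral_iff integrable_density integral_density)
  then have "has_bochner_integral lborel (\<lambda>u. std_normal_density (0 + sqrt (2 * pi * x) * u) * cos (t * (0 + sqrt (2 * pi * x) * u)))
     (exp (- (t\<^sup>2) / 2) /\<^sub>R \<bar>sqrt (2 * pi * x)\<bar>)"
    using assms by (intro lborel_has_bochner_integral_real_affine_iff[THEN iffD1]) auto
  from has_bochner_integral_mult_right[of "sqrt (2 * pi)", OF this]
  have "has_bochner_integral lborel (\<lambda>u. sqrt (2 * pi) * (std_normal_density (0 + sqrt (2 * pi * x) * u) * cos (t * (0 + sqrt (2 * pi * x) * u))))
     (sqrt (2 * pi) * (exp (- (t\<^sup>2) / 2) /\<^sub>R \<bar>sqrt (2 * pi * x)\<bar>))" by simp
  also have "sqrt (2 * pi) * (exp (- (t\<^sup>2) / 2) /\<^sub>R \<bar>sqrt (2 * pi * x)\<bar>) = exp (- pi * k\<^sup>2 / x) / sqrt x"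
    using assms by (simp add: t_def power_divide power_mult_distrib real_sqrt_mult field_simps power2_eq_square)
  also have "(\<lambda>u. sqrt (2 * pi) * (std_normal_density (0 + sqrt (2 * pi * x) * u) * cos (t * (0 + sqrt (2 * pi * x) * u))))
     = (\<lambda>u. exp (- pi * x * u\<^sup>2) * cos (2 * pi * k * u))"
    using assms by (simp add: t_def std_normal_density_def power_mult_distrib fun_eq_iff mult_ac)
  finally show ?thesis .
qed

lemma uniform_sums_integral:
  fixes g :: "nat \<Rightarrow> real \<Rightarrow> real"
  assumes cont: "\<And>n. continuous_on {a..b} (g n)"
    and bound: "\<And>n y. y \<in> {a..b} \<Longrightarrow> \<bar>g n y\<bar> \<le> M n" and M: "summable M"
  shows "continuous_on {a..b} (\<lambda>y. \<Sum>n. g n y)"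
    and "(\<lambda>n. integral {a..b} (g n)) sums integral {a..b} (\<lambda>y. \<Sum>n. g n y)"
proof -
  have u: "uniform_limit {a..b} (\<lambda>n y. \<Sum>i<n. g i y) (\<lambda>y. \<Sum>n. g n y) sequentially"
    using bound M by (intro Weierstrass_m_test) auto
  have c: "continuous_on {a..b} (\<lambda>y. \<Sum>i<n. g i y)" for n
    by (intro continuous_intros cont)
  show "continuous_on {a..b} (\<lambda>y. \<Sum>n. g n y)"
    by (rule uniform_limit_theorem[OF _ u]) (auto simp: c)
  obtain I J where IJ: "\<And>n. ((\<lambda>y. \<Sum>i<n. g i y) has_integral I n) {a..b}"
      "((\<lambda>y. \<Sum>n. g n y) has_integral J) {a..b}" "I \<longlonglongrightarrow> J"
    using uniform_limit_integral[OF u c] by auto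
  have "I n = (\<Sum>i<n. integral {a..b} (g i))" for n
    using integral_unique[OF IJ(1)[of n]] integrable_continuous_interval[OF cont]
    by (simp add: integral_sum)
  then have "I = (\<lambda>n. \<Sum>i<n. integral {a..b} (g i))" by blast
  then show "(\<lambda>n. integral {a..b} (g n)) sums integral {a..b} (\<lambda>y. \<Sum>n. g n y)"
    using IJ(3) integral_unique[OF IJ(2)] unfolding sums_def by simp
qed

text \<open>Dominated convergence with \<open>norm (g u)\<close> as majorant; it links Lebesgue
  integrals over the line to gauge integrals over compact intervals.\<close>

lemma integral_symmetric_interval_tendsto:
  fixes g :: "real \<Rightarrow> real"
  assumes "has_bochner_integral lborel g I"
  shows "(\<lambda>N. integral {- real N..real N} g) \<longlonglongrightarrow> I"
proof -
  have int: "integrable lborel g" and I: "integral\<^sup>L lborel g = I"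
    using assms by (auto simp: has_bochner_integral_iff)
  have "(\<lambda>N. LINT u|lborel. indicator {- real N..real N} u *\<^sub>R g u) \<longlonglongrightarrow> (LINT u|lborel. g u)"
  proof (rule integral_dominated_convergence[where w = "\<lambda>u. norm (g u)"])
    show "AE u in lborel. (\<lambda>N. indicator {- real N..real N} u *\<^sub>R g u) \<longlonglongrightarrow> g u"
    proof (rule AE_I2)
      fix u :: real
      have "\<forall>\<^sub>F N in sequentially. indicator {- real N..real N} u *\<^sub>R g u = g u"
        using eventually_ge_at_top[of "nat \<lceil>\<bar>u\<bar>\<rceil>"] by eventually_elim (auto simp: indicator_def abs_le_iff)
      then show "(\<lambda>N. indicator {- real N..real N} u *\<^sub>R g u) \<longlonglongrightarrow> g u"
        by (rule tendsto_eventually)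
    qed
  qed (use int in \<open>auto simp: indicator_def\<close>)
  moreover have "(LINT u|lborel. indicator {- real N..real N} u *\<^sub>R g u) = integral {- real N..real N} g" for N
    using set_borel_integral_eq_integral(2)[of "{- real N..real N}" g] int
      integrable_mult_indicator[of "{- real N..real N}" lborel g]
    by (simp add: set_lebesgue_integral_def set_integrable_def)
  ultimately show ?thesis using I by simp
qed

lemma summable_gaussian:
  fixes c :: real
  assumes "c > 0"
  shows "summable (\<lambda>n. exp (- c * (real n)\<^sup>2))"
proof (rule summable_comparison_test)
  show "\<exists>N. \<forall>n\<ge>N. norm (exp (- c * (real n)\<^sup>2)) \<le> exp (- c) ^ n"
  proof (intro exI[of _ 0] allI impI)
    fix n :: nat
    have "real n \<le> (real n)\<^sup>2"
      by (cases n) (auto simp: power2_eq_square)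
    then show "norm (exp (- c * (real n)\<^sup>2)) \<le> exp (- c) ^ n"
      using assms by (simp flip: exp_of_nat_mult)
  qed
  show "summable (\<lambda>n. exp (- c) ^ n)"
    using assms by (intro summable_geometric) auto
qed

text \<open>Riemann's psi function; \<open>1 + 2 * theta_tail x\<close> is the Jacobi theta
  function, the sum of \<open>exp (- pi * x * n\<^sup>2)\<close> over all integers
  \<open>n\<close>.\<close>

definition theta_tail :: "real \<Rightarrow> real" where
  "theta_tail x = (\<Sum>n. exp (- pi * x * (real (Suc n))\<^sup>2))"

lemma summable_theta_tail:
  "x > 0 \<Longrightarrow> summable (\<lambda>n. exp (- pi * x * (real (Suc n))\<^sup>2))"
  using summable_gaussian[of "pi * x"] by (subst summable_Suc_iff) simp

text \<open>Poisson summation for the Gaussian: the periodisation \<open>F\<close> and the cosine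
  series \<open>G\<close> are continuous and symmetric with equal cosine coefficients, so they
  agree, in particular at \<open>0\<close>.\<close>

theorem theta_transformation:
  assumes x: "x > 0"
  shows "1 + 2 * theta_tail x = (1 + 2 * theta_tail (1 / x)) / sqrt x"
proof -
  define f where "f u = exp (- pi * x * u\<^sup>2)" for u
  \<comment> \<open>The sum of \<open>f (n + y)\<close> over all integers \<open>n\<close>, the
    negative ones folded over by evenness, so that \<open>y \<mapsto> 1 - y\<close> swaps the two
    summands.\<close>
  define F where "F y = (\<Sum>n. f (real n + y) + f (real n + 1 - y))" for y
  define c where "c k = exp (- pi * (1 / x) * (real k)\<^sup>2)" for k
  define G where "G y = (1 + 2 * (\<Sum>k. c (Suc k) * cos (2 * pi * Suc k * y))) / sqrt x" for y
  have f_even: "f (- u) = f u" for u by (simp add: f_def)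
  have f_mono: "f u \<le> f v" if "0 \<le> v" "v \<le> u" for u v
    using x that by (auto simp: f_def power_mono)
  have f_nonneg: "f u \<ge> 0" for u by (simp add: f_def)
  have sum_f: "summable (\<lambda>n. f (real n))"
    using summable_gaussian[of "pi * x"] x by (simp add: f_def)
  have sum_c: "summable (\<lambda>k. c (Suc k))"
    using summable_gaussian[of "pi * (1 / x)"] x unfolding c_def by (subst summable_Suc_iff) simp
  have c_nonneg: "c k \<ge> 0" for k by (simp add: c_def)
  have F_bound: "\<bar>f (real n + y) + f (real n + 1 - y)\<bar> \<le> 2 * f (real n)" if "y \<in> {0..1}" for n y
    using f_mono[of "real n" "real n + y"] f_mono[of "real n" "real n + 1 - y"] f_nonneg that by fastforce
  have f_cont: "continuous_on A f" for A
    unfolding f_def by (intro continuous_intros)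
  have fc: "continuous_on A (\<lambda>x. f (g x))" if "continuous_on A g" for A and g :: "real \<Rightarrow> real"
    using continuous_on_compose[OF that f_cont] by (simp add: o_def)
  have F_cont: "continuous_on {0..1} F"
    unfolding F_def
    by (rule uniform_sums_integral(1)[where M = "\<lambda>n. 2 * f (real n)"])
       (auto intro!: fc continuous_intros summable_mult sum_f F_bound simp del: of_nat_Suc)
  have G_cont: "continuous_on {0..1} G"
    unfolding G_def
    by (intro continuous_intros uniform_sums_integral(1)[where M = "\<lambda>k. c (Suc k)"])
       (use x in \<open>auto intro!: continuous_intros sum_c simp: abs_mult mult_left_le c_nonneg simp del: of_nat_Suc\<close>)
  have F_sym: "F (1 - y) = F y" for y
    by (simp add: F_def algebra_simps)
  have G_sym: "G (1 - y) = G y" for y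
  proof -
    have "cos (2 * pi * real k * (1 - y)) = cos (2 * pi * real k * y)" for k
      using cos_diff[of "2 * pi * real k" "2 * pi * real k * y"] sin_int_2pin[of "int k"] cos_int_2pin[of "int k"]
      by (simp add: algebra_simps)
    then show ?thesis by (simp add: G_def del: of_nat_Suc)
  qed
  have F_coeff: "integral {0..1} (\<lambda>y. F y * cos (2 * pi * k * y)) = c k / sqrt x" for k :: nat
  proof -
    define g where "g u = f u * cos (2 * pi * real k * u)" for u
    have g_even: "g (- u) = g u" for u by (simp add: g_def f_even)
    have g_cont: "continuous_on A g" for A unfolding g_def by (intro continuous_intros f_cont)
    have g_int: "g integrable_on {a..b}" for a b by (intro integrable_continuous_interval g_cont)
    \<comment> \<open>A translation takes one half of the summand, and a reflection the other, to
      the same integral over a unit interval; the cosine has period one.\<close>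
    have summand: "integral {0..1} (\<lambda>y. (f (real n + y) + f (real n + 1 - y)) * cos (2 * pi * real k * y))
       = 2 * integral {real n..real (Suc n)} g" for n
    proof -
      have cos_shift: "cos (2 * pi * real k * (real m + y)) = cos (2 * pi * real k * y)" for m y
        using cos_add[of "2 * pi * (real k * real m)" "2 * pi * real k * y"]
          sin_int_2pin[of "int (k * m)"] cos_int_2pin[of "int (k * m)"]
        by (simp add: algebra_simps)
      have "(f (real n + y) + f (real n + 1 - y)) * cos (2 * pi * real k * y)
        = g (y + real n) + g (- y + (real n + 1))" for y
        using cos_shift[of n y] cos_shift[of "Suc n" "-y"] by (simp add: g_def algebra_simps)
      moreover have i1: "((\<lambda>y. g (y + real n)) has_integral integral {real n..real (Suc n)} g) {0..1}"
        using has_integral_affinity'[of g "integral {real n..real (Suc n)} g" "real n" "real (Suc n)" 1 "real n"]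
          integrable_integral[OF g_int] by simp
      moreover have i2: "((\<lambda>y. g (- y + (real n + 1))) has_integral integral {real n..real (Suc n)} g) {0..1}"
        using has_integral_affinity'[of g "integral {real n..real (Suc n)} g" "real n" "real (Suc n)" 1 "real n + 1"]
          integrable_integral[OF g_int] has_integral_reflect_real[of "\<lambda>y. g (y + (real n + 1))" _ 0 "-1"] by simp
      ultimately show ?thesis
        using integral_unique[OF has_integral_add[OF i1 i2]] by simp
    qed
    have 1: "(\<lambda>n. 2 * integral {real n..real (Suc n)} g) sums integral {0..1} (\<lambda>y. F y * cos (2 * pi * k * y))"
    proof -
      have "(\<lambda>n. integral {0..1} (\<lambda>y. (f (real n + y) + f (real n + 1 - y)) * cos (2 * pi * real k * y))) sums
         integral {0..1} (\<lambda>y. \<Sum>n. (f (real n + y) + f (real n + 1 - y)) * cos (2 * pi * real k * y))"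
      proof (rule uniform_sums_integral(2)[where M = "\<lambda>n. 2 * f (real n)"])
        fix n and y :: real assume y: "y \<in> {0..1}"
        have "\<bar>f (real n + y) + f (real n + 1 - y)\<bar> * \<bar>cos (2 * pi * real k * y)\<bar> \<le> 2 * f (real n) * 1"
          by (intro mult_mono F_bound[OF y]) (auto simp: f_nonneg)
        then show "\<bar>(f (real n + y) + f (real n + 1 - y)) * cos (2 * pi * real k * y)\<bar> \<le> 2 * f (real n)"
          by (simp add: abs_mult)
      qed (auto intro!: fc continuous_intros summable_mult sum_f)
      moreover have "(\<Sum>n. (f (real n + y) + f (real n + 1 - y)) * cos (2 * pi * real k * y)) = F y * cos (2 * pi * real k * y)"
        if "y \<in> {0..1}" for y
        unfolding F_def using F_bound[OF that]
        by (intro suminf_mult2[symmetric] summable_comparison_test'[OF summable_mult[OF sum_f, of 2]]) auto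
      then have "integral {0..1} (\<lambda>y. \<Sum>n. (f (real n + y) + f (real n + 1 - y)) * cos (2 * pi * real k * y)) =
          integral {0..1} (\<lambda>y. F y * cos (2 * pi * k * y))"
        by (rule integral_cong)
      ultimately show ?thesis by (simp only: summand)
    qed
    have 2: "(\<Sum>n<N. 2 * integral {real n..real (Suc n)} g) = integral {- real N..real N} g" for N
    proof (induction N)
      case (Suc N)
      have "integral {- real (Suc N)..real (Suc N)} g =
          integral {- real (Suc N)..- real N} g + integral {- real N..real N} g + integral {real N..real (Suc N)} g"
        using Henstock_Kurzweil_Integration.integral_combine[OF _ _ g_int, of "- real (Suc N)" "- real N" "real (Suc N)"]
              Henstock_Kurzweil_Integration.integral_combine[OF _ _ g_int, of "- real N" "real N" "real (Suc N)"] by simp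
      moreover have "integral {- real (Suc N)..- real N} g = integral {real N..real (Suc N)} g"
        using Henstock_Kurzweil_Integration.integral_reflect_real[where f = g and a = "real N" and b = "real (Suc N)"]
        unfolding g_even .
      ultimately show ?case using Suc by simp
    qed simp
    have "(\<lambda>N. integral {- real N..real N} g) \<longlonglongrightarrow> c k / sqrt x"
      using integral_symmetric_interval_tendsto[OF gaussian_cosine_integral[OF x, of "real k"]]
      by (simp add: g_def[abs_def] f_def c_def)
    moreover have "(\<lambda>N. integral {- real N..real N} g) \<longlonglongrightarrow> integral {0..1} (\<lambda>y. F y * cos (2 * pi * k * y))"
      using 1 unfolding sums_def 2 .
    ultimately show ?thesis by (rule LIMSEQ_unique[rotated])
  qed
  have G_coeff: "integral {0..1} (\<lambda>y. G y * cos (2 * pi * k * y)) = c k / sqrt x" for k :: nat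
  proof -
    \<comment> \<open>The product splits into frequencies \<open>j - k\<close> and
      \<open>j + k\<close>; both vanish only for \<open>j = k = 0\<close>, where the integral is
      \<open>1\<close> instead of \<open>1/2\<close>.\<close>
    have cc: "((\<lambda>y. cos (2 * pi * real j * y) * cos (2 * pi * real k * y)) has_integral
        (if j = k then 1/2 else 0) + (if j = 0 \<and> k = 0 then 1/2 else 0)) {0..1}" for j
    proof -
      have i: "((\<lambda>y. cos (2 * pi * of_int m * y) / 2) has_integral (if m = 0 then 1/2 else 0)) {0..1}" for m
        using integrable_integral[of "\<lambda>y. cos (2 * pi * of_int m * y)" "{0..1}"] integral_cos_2pi[of m]
          has_integral_divide[of "\<lambda>y. cos (2 * pi * of_int m * y)" _ "{0..1}" 2]
        by (force intro!: integrable_continuous_interval continuous_intros)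
      have *: "cos (2 * pi * real j * y) * cos (2 * pi * real k * y) =
         cos (2 * pi * of_int (int j - int k) * y) / 2 + cos (2 * pi * of_int (int j + int k) * y) / 2" for y
        unfolding cos_times_cos by (simp add: algebra_simps add_divide_distrib)
      have **: "(if j = k then 1/2 else 0) + (if j = 0 \<and> k = 0 then 1/2 else 0) =
          (if int j - int k = 0 then 1/2 else 0) + (if int j + int k = 0 then 1/2 else (0::real))"
        by auto
      show ?thesis
        unfolding * ** by (rule has_integral_add[OF i i])
    qed
    define S where "S y = (\<Sum>j. c (Suc j) * cos (2 * pi * Suc j * y) * cos (2 * pi * real k * y))" for y
    have S: "S y = (\<Sum>j. c (Suc j) * cos (2 * pi * Suc j * y)) * cos (2 * pi * real k * y)" for y
      unfolding S_def
      by (intro suminf_mult2[symmetric] summable_comparison_test'[OF sum_c]) 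
         (auto simp: abs_mult c_nonneg mult_left_le)
    have b: "\<bar>c (Suc j) * cos (2 * pi * Suc j * y) * cos (2 * pi * real k * y)\<bar> \<le> c (Suc j)" for j y
      unfolding abs_mult using c_nonneg[of "Suc j"] by (simp add: mult_left_le mult_le_one mult.assoc)
    have "(\<lambda>j. integral {0..1} (\<lambda>y. c (Suc j) * cos (2 * pi * Suc j * y) * cos (2 * pi * real k * y))) sums integral {0..1} S"
      unfolding S_def by (rule uniform_sums_integral(2)[OF _ _ sum_c]) (auto intro!: continuous_intros b simp del: of_nat_Suc)
    \<comment> \<open>\<open>S\<close> begins at frequency one, so only the index
      \<open>k - 1\<close> contributes. For \<open>k = 0\<close> nothing does, although truncated
      subtraction gives the index \<open>0\<close>; that coefficient comes from the constant term of
      \<open>G\<close>.\<close>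
    moreover have "integral {0..1} (\<lambda>y. c (Suc j) * cos (2 * pi * Suc j * y) * cos (2 * pi * real k * y)) =
       (if j = k - 1 then (if k = 0 then 0 else c k / 2) else 0)" for j
      using integral_unique[OF has_integral_mult_right[OF cc[of "Suc j"], of "c (Suc j)"]]
      by (cases k) (auto simp: mult.assoc)
    ultimately have "(\<lambda>j. if j = k - 1 then (if k = 0 then 0 else c k / 2) else 0) sums integral {0..1} S" by simp
    then have S_int: "integral {0..1} S = (if k = 0 then 0 else c k / 2)"
      using sums_unique2[OF _ sums_single[of "k - 1" "\<lambda>_. if k = 0 then 0 else c k / 2"]] by blast
    have "continuous_on {0..1} S"
      unfolding S_def by (rule uniform_sums_integral(1)[OF _ _ sum_c]) (auto intro!: continuous_intros b simp del: of_nat_Suc)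
    then have "(S has_integral (if k = 0 then 0 else c k / 2)) {0..1}"
      using S_int by (metis integrable_continuous_interval integrable_integral)
    from has_integral_divide[OF has_integral_add[OF cc[of 0] has_integral_mult_right[OF this, of 2]], of "sqrt x"]
    have "((\<lambda>y. G y * cos (2 * pi * k * y)) has_integral c k / sqrt x) {0..1}"
      by (auto simp: G_def S c_def algebra_simps add_divide_distrib split: if_splits)
    then show ?thesis by (rule integral_unique)
  qed
  have "F 0 - G 0 = 0"
  proof (rule cosine_series_unique[where H = "\<lambda>y. F y - G y"])
    fix k :: nat
    have "integral {0..1} (\<lambda>y. F y * cos (2 * pi * k * y) - G y * cos (2 * pi * k * y)) = 0"
      by (subst integral_diff) (auto intro!: integrable_continuous_interval continuous_intros F_cont G_cont simp: F_coeff G_coeff)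
    then show "integral {0..1} (\<lambda>y. (F y - G y) * cos (2 * pi * k * y)) = 0"
      by (simp add: algebra_simps)
  qed (auto intro!: continuous_intros F_cont G_cont simp: F_sym G_sym)
  moreover have "G 0 = (1 + 2 * theta_tail (1 / x)) / sqrt x"
    by (simp add: G_def theta_tail_def c_def)
  moreover have "F 0 = 1 + 2 * theta_tail x"
  proof -
    have f1: "summable (\<lambda>n. f (real n + 1))"
      using summable_theta_tail[OF x] by (simp add: f_def add_ac)
    have "F 0 = (\<Sum>n. f (real n)) + (\<Sum>n. f (real n + 1))"
      unfolding F_def using suminf_add[OF sum_f f1] by simp
    also have "(\<Sum>n. f (real n)) = f 0 + (\<Sum>n. f (real n + 1))"
      using suminf_split_head[OF sum_f] by (simp add: add_ac)
    finally show ?thesis by (simp add: theta_tail_def f_def add_ac)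
  qed
  ultimately show ?thesis by simp
qed

subsection \<open>Mellin transform of the theta function\<close>

text \<open>Euler's integral after \<open>t = exp w\<close>; the Jacobian restores the exponent
  \<open>z\<close>, and the domain becomes the whole line.\<close>

lemma has_bochner_integral_Gamma_exp:
  assumes z: "Re z > 0"
  shows "has_bochner_integral lborel (\<lambda>w. exp (z * of_real w) * of_real (exp (- exp w))) (Gamma z)"
proof -
  define f where "f t = complex_of_real t powr (z - 1) / of_real (exp t)" for t
  have img: "range exp = {0::real<..}"
    by (auto intro: exp_ln[symmetric])
  have "f absolutely_integrable_on range exp \<and> integral (range exp) f = Gamma z"
    unfolding img f_def
    using absolutely_integrable_Gamma_integral'[OF z] Gamma_integral_complex'[OF z] by (auto dest: integral_unique)
  then have *: "(\<lambda>w. \<bar>exp w\<bar> *\<^sub>R f (exp w)) absolutely_integrable_on UNIV \<and>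
      integral UNIV (\<lambda>w. \<bar>exp w\<bar> *\<^sub>R f (exp w)) = Gamma z"
    by (subst has_absolute_integral_change_of_variables_real) (auto intro!: derivative_eq_intros injI)
  also have "(\<lambda>w. \<bar>exp w\<bar> *\<^sub>R f (exp w)) = (\<lambda>w. exp (z * of_real w) * of_real (exp (- exp w)))"
  proof
    fix w :: real
    have "Ln (complex_of_real (exp w)) = of_real w"
      by (subst Ln_of_real) auto
    then have "complex_of_real (exp w) powr (z - 1) = exp ((z - 1) * of_real w)"
      by (simp add: powr_def)
    then show "\<bar>exp w\<bar> *\<^sub>R f (exp w) = exp (z * of_real w) * of_real (exp (- exp w))"
      by (simp add: f_def scaleR_conv_of_real exp_minus algebra_simps exp_diff field_simps flip: exp_of_real)
  qed
  finally have 1: "set_integrable lebesgue UNIV (\<lambda>w. exp (z * of_real w) * of_real (exp (- exp w)))"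
    and 2: "integral UNIV (\<lambda>w. exp (z * of_real w) * of_real (exp (- exp w))) = Gamma z" by auto
  have "integrable lborel (\<lambda>w. exp (z * of_real w) * of_real (exp (- exp w)))"
    using 1 by (subst integrable_completion[symmetric]) (auto simp: set_integrable_def)
  then show ?thesis
    using 2 integral_lborel[of "\<lambda>w. exp (z * of_real w) * of_real (exp (- exp w))"]
    by (simp add: has_bochner_integral_iff)
qed

text \<open>The affine substitution \<open>w = ln a + 2 * v\<close> in the previous integral, at the
  parameter \<open>s / 2\<close>.\<close>

lemma has_bochner_integral_gaussian_exp:
  fixes a :: real
  assumes s: "Re s > 0" and a: "a > 0"
  shows "has_bochner_integral lborel (\<lambda>v. exp (s * of_real v) * of_real (exp (- a * exp (2 * v))))
           (Gamma (s / 2) * exp (- s / 2 * of_real (ln a)) / 2)"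
proof -
  have "has_bochner_integral lborel
      (\<lambda>v. exp (s / 2 * of_real (ln a + 2 * v)) * of_real (exp (- exp (ln a + 2 * v)))) (Gamma (s / 2) /\<^sub>R \<bar>2\<bar>)"
    using has_bochner_integral_Gamma_exp[of "s / 2"] s
    by (intro lborel_has_bochner_integral_real_affine_iff[THEN iffD1]) auto
  from has_bochner_integral_mult_right[of "exp (- s / 2 * of_real (ln a))", OF this]
  have "has_bochner_integral lborel
      (\<lambda>v. exp (- s / 2 * of_real (ln a)) * (exp (s / 2 * of_real (ln a + 2 * v)) * of_real (exp (- exp (ln a + 2 * v)))))
      (Gamma (s / 2) * exp (- s / 2 * of_real (ln a)) / 2)"
    by (simp add: scaleR_conv_of_real field_simps)
  also have "(\<lambda>v. exp (- s / 2 * of_real (ln a)) * (exp (s / 2 * of_real (ln a + 2 * v)) * of_real (exp (- exp (ln a + 2 * v)))))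
     = (\<lambda>v. exp (s * of_real v) * of_real (exp (- a * exp (2 * v))))"
  proof
    fix v :: real
    have "exp (- s / 2 * of_real (ln a)) * exp (s / 2 * of_real (ln a + 2 * v)) = exp (s * of_real v)"
      unfolding exp_add[symmetric] by (rule arg_cong[where f = exp]) (simp add: field_simps)
    then show "exp (- s / 2 * of_real (ln a)) * (exp (s / 2 * of_real (ln a + 2 * v)) * of_real (exp (- exp (ln a + 2 * v)))) =
        exp (s * of_real v) * of_real (exp (- a * exp (2 * v)))"
      using a by (simp only: mult.assoc[symmetric] exp_add exp_ln minus_mult_left)
  qed
  finally show ?thesis .
qed

text \<open>The theta function without its constant term, in a logarithmic variable, so that the
  Mellin kernel becomes \<open>exp (s * v)\<close>.\<close>

definition theta_kernel :: "real \<Rightarrow> real" where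
  "theta_kernel v = 2 * theta_tail (exp (2 * v))"

lemma theta_kernel_sums:
  "(\<lambda>n. 2 * exp (- (pi * (real (Suc n))\<^sup>2) * exp (2 * v))) sums theta_kernel v"
  unfolding theta_kernel_def theta_tail_def
  using summable_sums[OF summable_theta_tail[of "exp (2 * v)"]] by (intro sums_mult) (simp add: mult_ac)

lemma theta_kernel_nonneg: "theta_kernel v \<ge> 0"
  unfolding theta_kernel_def theta_tail_def
  by (intro mult_nonneg_nonneg suminf_nonneg summable_theta_tail) auto

text \<open>The theta transformation reads
  \<open>1 + theta_kernel (- u) = exp u * (1 + theta_kernel u)\<close> in this variable.\<close>

lemma theta_kernel_minus: "theta_kernel (- u) = exp u - 1 + exp u * theta_kernel u"
proof -
  have "sqrt (exp (- (2 * u))) = exp (- u)"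
    by (rule real_sqrt_unique) (auto simp flip: exp_double)
  then have "1 + 2 * theta_tail (exp (- (2 * u))) = (1 + 2 * theta_tail (exp (2 * u))) / exp (- u)"
    using theta_transformation[of "exp (- (2 * u))"] by (simp add: exp_minus inverse_eq_divide)
  then show ?thesis
    by (simp add: theta_kernel_def exp_minus field_simps)
qed

section \<open>The Mellin transform as a Dirichlet series\<close>

lemma summable_Suc_powr:
  fixes r :: real
  assumes "r > 1"
  shows "summable (\<lambda>n. 1 / real (Suc n) powr r)"
  using assms summable_real_powr_iff[of "- r"] summable_Suc_iff[of "\<lambda>n. real n powr (- r)"]
  by (simp add: powr_minus_divide)

lemma cmod_of_nat_Suc_powr: "cmod (of_nat (Suc n) powr s) = real (Suc n) powr Re s"
  by (subst norm_powr_real_powr) auto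

text \<open>Each theta term integrates to a Gamma factor times one Dirichlet term. Sum and integral
  commute because the integrals of the norms are the same expressions at the real point
  \<open>Re s\<close>, hence summable.\<close>

lemma
  assumes s: "Re s > 1"
  shows integrable_mellin_theta: "integrable lborel (\<lambda>v. exp (s * of_real v) * of_real (theta_kernel v))"
    and mellin_theta_sums: "(\<lambda>n. of_real pi powr (- s / 2) * Gamma (s / 2) * (1 / of_nat (Suc n) powr s)) sums
           (LINT v|lborel. exp (s * of_real v) * of_real (theta_kernel v))"
proof -
  define a where "a n = pi * (real (Suc n))\<^sup>2" for n
  define f where "f n v = 2 * (exp (s * of_real v) * of_real (exp (- a n * exp (2 * v))))" for n v
  have a: "a n > 0" for n by (simp add: a_def)
  have ln_a: "ln (a n) = ln pi + 2 * ln (real (Suc n))" for n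
    by (simp add: a_def ln_mult ln_realpow del: of_nat_Suc)
  \<comment> \<open>Needed at \<open>s\<close> and, for the norms, at its real part
    \<open>r\<close>; hence the general \<open>z\<close>.\<close>
  have int: "has_bochner_integral lborel (\<lambda>v. 2 * (exp (z * of_real v) * of_real (exp (- a n * exp (2 * v)))))
      (of_real pi powr (- z / 2) * Gamma (z / 2) * (1 / of_nat (Suc n) powr z))" if "Re z > 1" for n z
  proof -
    have "exp (- z / 2 * of_real (ln (a n))) = exp (- z / 2 * of_real (ln pi) - z * of_real (ln (real (Suc n))))"
      unfolding ln_a by (rule arg_cong[where f = exp]) (simp add: field_simps del: of_nat_Suc)
    also have "\<dots> = of_real pi powr (- z / 2) * (1 / of_nat (Suc n) powr z)"
      using Ln_of_real[of pi] Ln_of_real[of "real (Suc n)"]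
      by (simp add: powr_def exp_diff del: of_nat_Suc)
    finally show ?thesis
      using has_bochner_integral_mult_right[of 2, OF has_bochner_integral_gaussian_exp[of z "a n"]] that a
      by (simp add: mult_ac)
  qed
  have f: "has_bochner_integral lborel (f n) (of_real pi powr (- s / 2) * Gamma (s / 2) * (1 / of_nat (Suc n) powr s))" for n
    using int[OF s] by (simp add: f_def [abs_def])
  define r where "r = complex_of_real (Re s)"
  have nf: "(LINT v|lborel. norm (f n v)) = norm (of_real pi powr (- r / 2) * Gamma (r / 2)) * (1 / real (Suc n) powr Re s)" for n
  proof -
    have "2 * (exp (r * of_real v) * of_real (exp (- a n * exp (2 * v)))) = complex_of_real (norm (f n v))" for v
      by (simp add: f_def norm_mult r_def exp_of_real[symmetric])
    then have "(LINT v|lborel. complex_of_real (norm (f n v))) =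
        of_real pi powr (- r / 2) * Gamma (r / 2) * (1 / of_nat (Suc n) powr r)"
      using int[of r n] s by (intro has_bochner_integral_integral_eq) (simp add: r_def)
    then have "norm (LINT v|lborel. complex_of_real (norm (f n v))) =
        norm (of_real pi powr (- r / 2) * Gamma (r / 2)) * (1 / real (Suc n) powr Re s)"
      by (simp only: norm_mult norm_divide norm_one cmod_of_nat_Suc_powr r_def Re_complex_of_real)
    then show ?thesis by simp
  qed
  have f_sums: "(\<lambda>n. f n v) sums (exp (s * of_real v) * of_real (theta_kernel v))" for v
    using sums_mult[OF sums_of_real[OF theta_kernel_sums[of v]], of "exp (s * of_real v)"]
    by (simp add: f_def a_def mult_ac)
  have summ: "summable (\<lambda>n. norm (f n v))" for v
  proof -
    have "(\<lambda>n. norm (f n v)) = (\<lambda>n. exp (Re s * v) * (2 * exp (- (pi * (real (Suc n))\<^sup>2) * exp (2 * v))))"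
      by (simp add: f_def a_def norm_mult mult_ac)
    then show ?thesis using sums_summable[OF theta_kernel_sums[of v]] by (simp add: summable_mult)
  qed
  have summ2: "summable (\<lambda>n. LINT v|lborel. norm (f n v))"
    unfolding nf by (intro summable_mult summable_Suc_powr s)
  show "integrable lborel (\<lambda>v. exp (s * of_real v) * of_real (theta_kernel v))"
    using integrable_suminf[of lborel f] f summ summ2 f_sums
    by (simp add: has_bochner_integral_iff sums_iff)
  show "(\<lambda>n. of_real pi powr (- s / 2) * Gamma (s / 2) * (1 / of_nat (Suc n) powr s)) sums
           (LINT v|lborel. exp (s * of_real v) * of_real (theta_kernel v))"
    using sums_integral[of lborel f] f summ summ2 f_sums
    by (simp add: has_bochner_integral_iff sums_iff)
qed

text \<open>The part of the Mellin integral over \<open>x > 1\<close>, where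
  \<open>theta_kernel\<close> decays so fast that it converges for every \<open>s\<close>, not only
  for \<open>Re s > 1\<close>.\<close>

definition half_mellin :: "complex \<Rightarrow> complex" where
  "half_mellin s = (LINT v|lborel. indicator {0<..} v *\<^sub>R (exp (s * of_real v) * of_real (theta_kernel v)))"

lemma theta_kernel_measurable [measurable]: "theta_kernel \<in> borel_measurable borel"
proof -
  have "(\<lambda>v. \<Sum>n. 2 * exp (- (pi * (real (Suc n))\<^sup>2) * exp (2 * v))) \<in> borel_measurable borel"
    by measurable
  then show ?thesis
    by (simp only: sums_unique[OF theta_kernel_sums, symmetric])
qed

text \<open>For \<open>v > 0\<close> a larger exponent only increases the integrand, and
  \<open>\<bar>r\<bar> + 2\<close> exceeds both \<open>r\<close> and the bound \<open>1\<close> of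
  the full integral.\<close>

lemma integrable_half_mellin_real:
  fixes r :: real
  shows "integrable lborel (\<lambda>v. indicator {0<..} v * (exp (r * v) * theta_kernel v))"
proof (rule Bochner_Integration.integrable_bound)
  show "integrable lborel (\<lambda>v. exp (of_real (\<bar>r\<bar> + 2) * of_real v) * complex_of_real (theta_kernel v))"
    by (rule integrable_mellin_theta) auto
  show "AE v in lborel. norm (indicator {0<..} v * (exp (r * v) * theta_kernel v))
      \<le> norm (exp (of_real (\<bar>r\<bar> + 2) * of_real v) * complex_of_real (theta_kernel v))"
  proof (rule AE_I2)
    fix v :: real
    have "r * v \<le> (\<bar>r\<bar> + 2) * v" if "v > 0"
      using that by (intro mult_right_mono) auto
    then show "norm (indicator {0<..} v * (exp (r * v) * theta_kernel v))
      \<le> norm (exp (of_real (\<bar>r\<bar> + 2) * of_real v) * complex_of_real (theta_kernel v))"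
      using theta_kernel_nonneg[of v]
      by (auto simp: indicator_def norm_mult simp del: of_real_add intro!: mult_right_mono)
  qed
qed measurable

lemma integrable_half_mellin:
  fixes s :: complex
  shows "integrable lborel (\<lambda>v. indicator {0<..} v *\<^sub>R (exp (s * of_real v) * of_real (theta_kernel v)))"
  by (rule Bochner_Integration.integrable_bound[OF integrable_half_mellin_real[of "Re s"]])
     (auto simp: norm_mult indicator_def theta_kernel_nonneg)

lemma half_mellin_of_real:
  "half_mellin (of_real r) = of_real (LINT v|lborel. indicator {0<..} v * (exp (r * v) * theta_kernel v))"
proof -
  have "indicator {0<..} v *\<^sub>R (exp (of_real r * of_real v) * complex_of_real (theta_kernel v)) =
      of_real (indicator {0<..} v * (exp (r * v) * theta_kernel v))" for v
    by (simp add: indicator_def exp_of_real[symmetric])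
  then show ?thesis by (simp only: half_mellin_def integral_complex_of_real)
qed

lemma half_mellin_cnj: "half_mellin (cnj s) = cnj (half_mellin s)"
proof -
  have "cnj (half_mellin s) = (LINT v|lborel. cnj (indicator {0<..} v *\<^sub>R (exp (s * of_real v) * of_real (theta_kernel v))))"
    unfolding half_mellin_def by (rule Bochner_Integration.integral_cnj[symmetric])
  then show ?thesis
    by (simp add: half_mellin_def scaleR_conv_of_real exp_cnj)
qed

lemma Re_half_mellin_of_real_nonneg: "Re (half_mellin (of_real r)) \<ge> 0"
  unfolding half_mellin_of_real Re_complex_of_real
  by (intro integral_nonneg_AE AE_I2 mult_nonneg_nonneg theta_kernel_nonneg) auto

text \<open>Raising the exponent to \<open>r\<close> is harmless on \<open>v > 0\<close>, and the
  nonnegative kernel allows extension to the whole line, where the integral is a known Dirichlet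
  series.\<close>

lemma norm_half_mellin_le:
  assumes "Re s \<le> r" "r > 1"
  shows "norm (half_mellin s) \<le> Re (LINT v|lborel. exp (of_real r * of_real v) * of_real (theta_kernel v))"
proof -
  have "norm (half_mellin s) \<le> (LINT v|lborel. norm (indicator {0<..} v *\<^sub>R (exp (s * of_real v) * complex_of_real (theta_kernel v))))"
    unfolding half_mellin_def by (rule integral_norm_bound)
  also have "\<dots> \<le> (LINT v|lborel. Re (exp (of_real r * of_real v) * of_real (theta_kernel v)))"
  proof (rule integral_mono_AE)
    show "integrable lborel (\<lambda>v. norm (indicator {0<..} v *\<^sub>R (exp (s * of_real v) * complex_of_real (theta_kernel v))))"
      by (intro integrable_norm integrable_half_mellin)
    show "integrable lborel (\<lambda>v. Re (exp (of_real r * of_real v) * of_real (theta_kernel v)))"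
      using assms by (intro integrable_Re integrable_mellin_theta) auto
    have "norm (indicator {0<..} v *\<^sub>R (exp (s * of_real v) * complex_of_real (theta_kernel v)))
      \<le> Re (exp (of_real r * of_real v) * of_real (theta_kernel v))" for v
    proof -
      have "Re s * v \<le> r * v" if "v > 0" using that assms by (intro mult_right_mono) auto
      then show ?thesis
        using theta_kernel_nonneg[of v] by (auto simp: indicator_def norm_mult Re_exp intro!: mult_right_mono)
    qed
    then show "AE v in lborel. norm (indicator {0<..} v *\<^sub>R (exp (s * of_real v) * complex_of_real (theta_kernel v)))
      \<le> Re (exp (of_real r * of_real v) * of_real (theta_kernel v))" by simp
  qed
  also have "\<dots> = Re (LINT v|lborel. exp (of_real r * of_real v) * of_real (theta_kernel v))"
    using assms by (intro integral_Re integrable_mellin_theta) auto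
  finally show ?thesis .
qed

text \<open>Expanding \<open>exp (s * v)\<close> and integrating termwise gives an everywhere
  convergent power series; the integrand at the exponent \<open>norm s\<close> is the
  majorant.\<close>

lemma half_mellin_holomorphic: "half_mellin holomorphic_on A"
proof -
  define a where "a k = (LINT v|lborel. indicator {0<..} v *\<^sub>R (of_real v ^ k / fact k * complex_of_real (theta_kernel v)))" for k
  have sums: "(\<lambda>k. a k * (s - 0) ^ k) sums half_mellin s" for s
  proof -
    define f where "f k v = indicator {0<..} v *\<^sub>R ((s * of_real v) ^ k / fact k * complex_of_real (theta_kernel v))" for k v
    define b where "b v = indicator {0<..} v * (exp (norm s * v) * theta_kernel v)" for v
    have exp_sums: "(\<lambda>k. (norm s * v) ^ k / fact k) sums exp (norm s * v)" for v
      using exp_converges[of "norm s * v"] by (simp add: field_simps)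
    have nf: "norm (f k v) = indicator {0<..} v * ((norm s * v) ^ k / fact k * theta_kernel v)" for k v
      using theta_kernel_nonneg[of v]
      by (auto simp: f_def indicator_def norm_mult norm_divide norm_power abs_of_pos)
    have nf_sums: "(\<lambda>k. norm (f k v)) sums b v" for v
      unfolding nf b_def by (intro sums_mult sums_mult2 exp_sums)
    have b: "integrable lborel b"
      unfolding b_def by (rule integrable_half_mellin_real)
    have f_meas [measurable]: "f k \<in> borel_measurable borel" for k
      unfolding f_def by measurable
    have part: "(\<Sum>k<n. norm (f k v)) \<le> b v" for n v
      using sum_le_suminf[OF sums_summable[OF nf_sums[of v]], of "{..<n}"] sums_unique[OF nf_sums[of v]] by simp
    have f_int: "integrable lborel (f k)" for k
    proof (rule Bochner_Integration.integrable_bound[OF b])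
      have "norm (f k v) \<le> b v" for v
        using part[of v "Suc k"] sum_nonneg[of "{..<k}" "\<lambda>k. norm (f k v)"] by simp
      then show "AE v in lborel. norm (f k v) \<le> norm (b v)"
        by (intro AE_I2) (metis abs_ge_self order_trans real_norm_def)
    qed auto
    have "summable (\<lambda>k. LINT v|lborel. norm (f k v))"
    proof (rule summableI_nonneg_bounded[where x = "LINT v|lborel. b v"])
      fix n
      have "(\<Sum>k<n. LINT v|lborel. norm (f k v)) = (LINT v|lborel. (\<Sum>k<n. norm (f k v)))"
        using f_int by (intro Bochner_Integration.integral_sum[symmetric]) auto
      also have "\<dots> \<le> (LINT v|lborel. b v)"
        using f_int b part by (intro integral_mono) auto
      finally show "(\<Sum>k<n. LINT v|lborel. norm (f k v)) \<le> (LINT v|lborel. b v)" .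
    qed (auto intro: integral_nonneg_AE)
    then have "(\<lambda>k. integral\<^sup>L lborel (f k)) sums (LINT v|lborel. (\<Sum>k. f k v))"
      using f_int sums_summable[OF nf_sums] by (intro sums_integral) auto
    moreover have "integral\<^sup>L lborel (f k) = a k * (s - 0) ^ k" for k
    proof -
      have "f k = (\<lambda>v. (indicator {0<..} v *\<^sub>R (of_real v ^ k / fact k * complex_of_real (theta_kernel v))) * s ^ k)"
        by (simp add: f_def power_mult_distrib fun_eq_iff scaleR_conv_of_real mult_ac)
      then show ?thesis unfolding a_def by (simp only: integral_mult_left_zero diff_zero)
    qed
    moreover have "(\<Sum>k. f k v) = indicator {0<..} v *\<^sub>R (exp (s * of_real v) * of_real (theta_kernel v))" for v
    proof -
      have "(\<lambda>k. (s * of_real v) ^ k / fact k) sums exp (s * of_real v)"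
        using exp_converges[of "s * of_real v"] by (simp add: scaleR_conv_of_real field_simps)
      then have "(\<lambda>k. f k v) sums (indicator {0<..} v *\<^sub>R (exp (s * of_real v) * of_real (theta_kernel v)))"
        unfolding f_def by (intro sums_scaleR_right sums_mult2)
      then show ?thesis by (rule sums_unique[symmetric])
    qed
    ultimately show ?thesis by (simp add: half_mellin_def)
  qed
  have "half_mellin holomorphic_on ball 0 r" for r
    by (rule power_series_holomorphic) (rule sums)
  then have "half_mellin field_differentiable at s" for s
    using holomorphic_on_imp_differentiable_at[of half_mellin "ball 0 (norm s + 1)" s] by auto
  then show ?thesis
    by (simp add: field_differentiable_at_within holomorphic_on_def)
qed

text \<open>Source of the polar terms of the Mellin transform.\<close>

lemma has_bochner_integral_exp_half_line:
  assumes "Re c > 0"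
  shows "has_bochner_integral lborel (\<lambda>v. indicator {0<..} v *\<^sub>R exp (- c * of_real v)) (1 / c)"
proof -
  have ei: "einterval 0 \<infinity> = {0<..}"
    by (auto simp: einterval_iff)
  have int: "set_integrable lborel (einterval 0 \<infinity>) (\<lambda>v. exp (- c * of_real v))"
  proof -
    have "(\<lambda>v. exp (- Re c * v)) absolutely_integrable_on {0..}"
      using integrable_on_exp_minus_to_infinity[OF assms, of 0] by (subst absolutely_integrable_on_iff_nonneg) auto
    then have "integrable lebesgue (\<lambda>v. indicator {0..} v *\<^sub>R exp (- Re c * v))"
      by (simp add: set_integrable_def)
    then have "integrable lborel (\<lambda>v. indicator {0..} v *\<^sub>R exp (- Re c * v))"
      by (subst (asm) integrable_completion) auto
    then show ?thesis
      unfolding set_integrable_def ei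
      by (rule Bochner_Integration.integrable_bound) (auto simp: indicator_def)
  qed
  have "(LBINT v=0..\<infinity>. exp (- c * of_real v)) = 0 - (- 1 / c)"
  proof (rule interval_integral_FTC_integrable[where F = "\<lambda>v. - exp (- c * of_real v) / c"])
    show "((\<lambda>v. - exp (- c * of_real v) / c) has_vector_derivative exp (- c * of_real v)) (at v)" for v :: real
    proof -
      have "c \<noteq> 0" using assms by auto
      then have "((\<lambda>z. - exp (- c * z) / c) has_field_derivative exp (- c * of_real v)) (at (of_real v))"
        by (auto intro!: derivative_eq_intros)
      then show ?thesis
        by (rule has_vector_derivative_real_field)
    qed
    show "(((\<lambda>v. - exp (- c * of_real v) / c) \<circ> real_of_ereal) \<longlongrightarrow> - 1 / c) (at_right 0)"
      unfolding zero_ereal_def ereal_tendsto_simps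
      by (rule tendsto_eq_intros refl | simp)+ (use assms in auto)
    show "(((\<lambda>v. - exp (- c * of_real v) / c) \<circ> real_of_ereal) \<longlongrightarrow> 0) (at_left \<infinity>)"
      unfolding ereal_tendsto_simps
    proof (rule tendsto_norm_zero_cancel)
      have "((\<lambda>v. exp (- Re c * v)) \<longlongrightarrow> 0) at_top"
        using assms by real_asymp
      then have "((\<lambda>v. exp (- Re c * v) / norm c) \<longlongrightarrow> 0 / norm c) at_top"
        using assms by (intro tendsto_intros) auto
      then show "((\<lambda>v. norm (- exp (- c * of_real v) / c)) \<longlongrightarrow> 0) at_top"
        by (simp add: norm_divide)
    qed
  qed (use int in \<open>auto intro!: continuous_intros\<close>)
  then have "(LINT v|lborel. indicator {0<..} v *\<^sub>R exp (- c * of_real v)) = 1 / c"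
    by (simp add: interval_lebesgue_integral_def set_lebesgue_integral_def ei)
  then show ?thesis
    using int by (simp add: has_bochner_integral_iff set_integrable_def ei)
qed

subsection \<open>The xi function\<close>

text \<open>Riemann's splitting at \<open>v = 0\<close>: the negative half is folded over by
  \<open>theta_kernel_minus\<close>, whose elementary terms yield the two fractions. The result is
  invariant under \<open>s \<mapsto> 1 - s\<close>.\<close>

theorem mellin_theta_eq:
  assumes s: "Re s > 1"
  shows "(LINT v|lborel. exp (s * of_real v) * of_real (theta_kernel v)) =
      1 / (s - 1) - 1 / s + half_mellin s + half_mellin (1 - s)"
proof -
  define f where "f v = exp (s * of_real v) * complex_of_real (theta_kernel v)" for v
  \<comment> \<open>This is \<open>f (- v)\<close> for \<open>v > 0\<close>, expanded by the theta
    transformation; \<open>f\<close> is the Mellin integrand.\<close>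
  define g where "g v = indicator {0<..} v *\<^sub>R exp (- (s - 1) * of_real v) - indicator {0<..} v *\<^sub>R exp (- s * of_real v)
      + indicator {0<..} v *\<^sub>R (exp ((1 - s) * of_real v) * complex_of_real (theta_kernel v))" for v
  have g: "has_bochner_integral lborel g (1 / (s - 1) - 1 / s + half_mellin (1 - s))"
    unfolding g_def
    by (intro has_bochner_integral_add has_bochner_integral_diff has_bochner_integral_exp_half_line)
       (use s in \<open>auto simp: half_mellin_def has_bochner_integral_iff integrable_half_mellin\<close>)
  have "has_bochner_integral lborel (\<lambda>v. g (0 + (-1) * v)) ((1 / (s - 1) - 1 / s + half_mellin (1 - s)) /\<^sub>R \<bar>-1\<bar>)"
    using g by (intro lborel_has_bochner_integral_real_affine_iff[THEN iffD1]) auto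
  moreover have "has_bochner_integral lborel (\<lambda>v. indicator {0<..} v *\<^sub>R f v) (half_mellin s)"
    unfolding f_def by (simp add: half_mellin_def has_bochner_integral_iff integrable_half_mellin)
  ultimately have sum: "has_bochner_integral lborel (\<lambda>v. g (0 + (-1) * v) + indicator {0<..} v *\<^sub>R f v)
      ((1 / (s - 1) - 1 / s + half_mellin (1 - s)) /\<^sub>R \<bar>-1\<bar> + half_mellin s)"
    by (rule has_bochner_integral_add)
  \<comment> \<open>At \<open>v = 0\<close> both indicators vanish, so the identity holds only
    almost everywhere.\<close>
  have "g (0 + (-1) * v) + indicator {0<..} v *\<^sub>R f v = f v" if "v \<noteq> 0" for v
  proof (cases "v > 0")
    case False
    with that have v: "v < 0" by simp
    have "complex_of_real (theta_kernel v) = of_real (exp (- v) - 1 + exp (- v) * theta_kernel (- v))"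
      using theta_kernel_minus[of "- v"] by simp
    then have "f v = exp (s * of_real v) * (exp (- of_real v) - 1 + exp (- of_real v) * of_real (theta_kernel (- v)))"
      by (simp add: f_def exp_of_real[symmetric])
    also have "\<dots> = exp (s * of_real v + (- of_real v)) - exp (s * of_real v)
        + exp (s * of_real v + (- of_real v)) * of_real (theta_kernel (- v))"
      unfolding exp_add by (simp add: algebra_simps)
    also have "\<dots> = g (- v)"
      using v by (simp add: g_def algebra_simps)
    finally show ?thesis using v by simp
  qed (simp add: g_def)
  then have "AE v in lborel. g (0 + (-1) * v) + indicator {0<..} v *\<^sub>R f v = f v"
    using AE_lborel_singleton[of 0] by (auto elim!: AE_mp)
  moreover have "integrable lborel f"
    using integrable_mellin_theta[OF s] by (simp add: f_def[abs_def])
  ultimately have "(LINT v|lborel. g (0 + (-1) * v) + indicator {0<..} v *\<^sub>R f v) = integral\<^sup>L lborel f"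
    using sum by (intro integral_cong_AE) (auto simp: has_bochner_integral_iff)
  then show ?thesis
    using sum by (simp add: f_def[abs_def] has_bochner_integral_iff)
qed

text \<open>Since \<open>1 / (s - 1) - 1 / s = 1 / (s * (s - 1))\<close>, the factor
  \<open>s * (s - 1) / 2\<close> turns the polar part into the constant \<open>1 / 2\<close>; what
  remains is visibly entire and symmetric.\<close>

definition entire_xi :: "complex \<Rightarrow> complex" where
  "entire_xi s = 1 / 2 + s * (s - 1) / 2 * (half_mellin s + half_mellin (1 - s))"

lemma entire_xi_holomorphic: "entire_xi holomorphic_on A"
proof -
  have "(\<lambda>s. half_mellin (1 - s)) holomorphic_on A"
    using holomorphic_on_compose[of "\<lambda>s. 1 - s" A half_mellin, OF _ half_mellin_holomorphic]
    by (simp add: o_def holomorphic_intros)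
  then show ?thesis
    unfolding entire_xi_def by (intro holomorphic_intros half_mellin_holomorphic) auto
qed

lemma entire_xi_reflect: "entire_xi (1 - s) = entire_xi s"
  by (simp add: entire_xi_def algebra_simps)

lemma entire_xi_cnj: "entire_xi (cnj s) = cnj (entire_xi s)"
  using half_mellin_cnj[of "1 - s"] by (simp add: entire_xi_def half_mellin_cnj)

text \<open>At real \<open>r \<ge> 1\<close> the half-line integrals and \<open>r * (r - 1)\<close>
  are nonnegative, so the constant \<open>1 / 2\<close> survives. This anchors the lower bound in
  the half-plane.\<close>

lemma entire_xi_of_real_ge:
  fixes r :: real
  assumes "r \<ge> 1"
  shows "norm (entire_xi (of_real r)) \<ge> 1 / 2"
proof -
  have "entire_xi (of_real r) = of_real (1 / 2 + r * (r - 1) / 2 * (Re (half_mellin (of_real r)) + Re (half_mellin (of_real (1 - r)))))"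
  proof -
    have "half_mellin (of_real r) = of_real (Re (half_mellin (of_real r)))" for r
      by (subst (1 2) half_mellin_of_real) (simp only: Re_complex_of_real)
    from this[of r] this[of "1 - r"] show ?thesis
      by (simp add: entire_xi_def)
  qed
  moreover have "r * (r - 1) / 2 * (Re (half_mellin (of_real r)) + Re (half_mellin (of_real (1 - r)))) \<ge> 0"
    using assms by (intro mult_nonneg_nonneg add_nonneg_nonneg Re_half_mellin_of_real_nonneg) auto
  ultimately show ?thesis by (simp only: norm_of_real)
qed

section \<open>The product formula with Gamma and zeta\<close>

lemma entire_xi_sums:
  assumes s: "Re s > 1"
  shows "(\<lambda>n. 1 / 2 * s * (s - 1) * of_real pi powr (- s / 2) * Gamma (s / 2) * (1 / of_nat (Suc n) powr s)) sums entire_xi s"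
proof -
  have "s \<noteq> 0" "s - 1 \<noteq> 0" using s by auto
  then have "entire_xi s = 1 / 2 * s * (s - 1) * (1 / (s - 1) - 1 / s + half_mellin s + half_mellin (1 - s))"
    unfolding entire_xi_def by (simp add: field_simps)
  then show ?thesis
    using sums_mult[OF mellin_theta_sums[OF s], of "1 / 2 * s * (s - 1)"]
    by (simp only: mellin_theta_eq[OF s] mult.assoc)
qed

text \<open>Writing \<open>rGamma (s / 2 + 1)\<close> instead of \<open>rGamma (s / 2) / s\<close> avoids the removable singularity at \<open>0\<close>.\<close>
definition zeta_continuation :: "complex \<Rightarrow> complex" where
  "zeta_continuation s = (if s = 1 then 0 else entire_xi s * of_real pi powr (s / 2) * rGamma (s / 2 + 1) / (s - 1))"

lemma pi_powr_cancel: "complex_of_real pi powr (s / 2) * of_real pi powr (- s / 2) = 1"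
  by (simp add: powr_def exp_minus)

text \<open>Two functions meeting the description agree on \<open>Re s > 1\<close>, hence on the
  connected punctured plane by analytic continuation, and at \<open>1\<close> by convention.\<close>

lemma riemann_zeta_eq: "riemann_zeta = zeta_continuation"
  unfolding riemann_zeta_def
proof (rule the_equality)
  have hol: "zeta_continuation holomorphic_on - {1}"
  proof -
    have "(\<lambda>s. entire_xi s * of_real pi powr (s / 2) * rGamma (s / 2 + 1) / (s - 1)) holomorphic_on - {1}"
      by (intro holomorphic_intros entire_xi_holomorphic) auto
    then show ?thesis by (rule holomorphic_transform) (auto simp: zeta_continuation_def)
  qed
  have sums: "(\<lambda>n. 1 / of_nat (Suc n) powr s) sums zeta_continuation s" if s: "Re s > 1" for s
  proof -
    have ne: "s \<noteq> 0" "s \<noteq> 1" using s by auto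
    have nz: "s / 2 \<notin> \<int>\<^sub>\<le>\<^sub>0" using s by (auto elim!: nonpos_Ints_cases simp: complex_eq_iff)
    define A where "A = 1 / 2 * s * (s - 1) * of_real pi powr (- s / 2) * Gamma (s / 2)"
    have "s / 2 * rGamma (s / 2 + 1) = rGamma (s / 2)"
      by (rule rGamma_plus1)
    moreover have "Gamma (s / 2) * rGamma (s / 2) = 1"
      using nz by (simp add: rGamma_inverse_Gamma Gamma_eq_zero_iff)
    ultimately have 1: "Gamma (s / 2) * (s / 2 * rGamma (s / 2 + 1)) = 1" by simp
    have "A * (of_real pi powr (s / 2) * rGamma (s / 2 + 1) / (s - 1)) =
        (of_real pi powr (s / 2) * of_real pi powr (- s / 2)) * (Gamma (s / 2) * (s / 2 * rGamma (s / 2 + 1)))"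
      using ne by (simp add: A_def field_simps)
    also have "\<dots> = 1" unfolding 1 pi_powr_cancel by simp
    finally have 2: "of_real pi powr (s / 2) * rGamma (s / 2 + 1) / (s - 1) * A = 1" by (simp add: mult.commute)
    have "(\<lambda>n. of_real pi powr (s / 2) * rGamma (s / 2 + 1) / (s - 1) * (A * (1 / of_nat (Suc n) powr s))) sums
       (of_real pi powr (s / 2) * rGamma (s / 2 + 1) / (s - 1) * entire_xi s)"
      using entire_xi_sums[OF s] by (intro sums_mult) (simp add: A_def)
    moreover have "of_real pi powr (s / 2) * rGamma (s / 2 + 1) / (s - 1) * entire_xi s = zeta_continuation s"
      using ne by (simp add: zeta_continuation_def mult_ac)
    ultimately show ?thesis by (simp only: mult.assoc[symmetric] 2 mult_1_left)
  qed
  show "zeta_continuation holomorphic_on - {1} \<and>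
    (\<forall>s. 1 < Re s \<longrightarrow> (\<lambda>n. 1 / of_nat (Suc n) powr s) sums zeta_continuation s) \<and> zeta_continuation 1 = 0"
    using hol sums by (simp add: zeta_continuation_def)
  fix f
  assume f: "f holomorphic_on - {1} \<and> (\<forall>s. 1 < Re s \<longrightarrow> (\<lambda>n. 1 / of_nat (Suc n) powr s) sums f s) \<and> f 1 = 0"
  have "f s = zeta_continuation s" if "s \<noteq> 1" for s
  proof (rule analytic_continuation_open[of "{s. Re s > 1}" "- {1}" f zeta_continuation])
    show "{s. Re s > 1} \<noteq> {}" by (auto intro: exI[of _ 2])
    show "open {s. Re s > 1}" by (rule open_halfspace_Re_gt)
    show "connected (- {1::complex})" by (rule connected_punctured_universe) simp
    show "\<And>z. z \<in> {s. Re s > 1} \<Longrightarrow> f z = zeta_continuation z"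
      using f sums by (auto intro: sums_unique2)
  qed (use f hol that in \<open>auto simp: open_Compl\<close>)
  then show "f = zeta_continuation"
    using f by (auto simp: fun_eq_iff zeta_continuation_def)
qed

text \<open>Away from isolated points the product formula equals \<open>entire_xi\<close>, so
  \<open>entire_xi s\<close> is its limit everywhere, which is the value that
  \<open>remove_sings\<close> takes.\<close>

theorem riemann_xi_eq: "riemann_xi = entire_xi"
proof
  fix s :: complex
  define F where "F z = 1 / 2 * z * (z - 1) * of_real pi powr (- z / 2) * Gamma (z / 2) * riemann_zeta z" for z
  have eq: "F z = entire_xi z" if "z \<noteq> 1" "z / 2 \<notin> \<int>\<^sub>\<le>\<^sub>0" for z :: complex
  proof -
    have "z / 2 * rGamma (z / 2 + 1) = rGamma (z / 2)"
      by (rule rGamma_plus1)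
    moreover have "Gamma (z / 2) * rGamma (z / 2) = 1"
      using that by (simp add: rGamma_inverse_Gamma Gamma_eq_zero_iff)
    ultimately have 1: "Gamma (z / 2) * (z / 2 * rGamma (z / 2 + 1)) = 1" by simp
    have "F z = (of_real pi powr (z / 2) * of_real pi powr (- z / 2)) *
        (Gamma (z / 2) * (z / 2 * rGamma (z / 2 + 1))) * entire_xi z"
      using that by (simp add: F_def riemann_zeta_eq zeta_continuation_def field_simps)
    then show ?thesis unfolding 1 pi_powr_cancel by simp
  qed
  \<comment> \<open>All exceptional points are integers, and those do not accumulate.\<close>
  have "eventually (\<lambda>z. z \<noteq> 1 \<and> z / 2 \<notin> \<int>\<^sub>\<le>\<^sub>0) (at s)"
  proof -
    have "\<not> s islimpt \<int>"
      by (rule discrete_imp_not_islimpt[of 1]) (auto elim!: Ints_cases simp: dist_norm simp flip: of_int_diff)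
    then have "eventually (\<lambda>z. z \<notin> \<int>) (at s)"
      by (simp add: islimpt_iff_eventually)
    then show ?thesis
    proof eventually_elim
      case (elim z)
      have False if "z / 2 = of_int n" for n
      proof -
        have "z = of_int (2 * n)" using that by simp
        then show False using elim Ints_of_int by blast
      qed
      then show ?case using elim by (auto elim!: nonpos_Ints_cases)
    qed
  qed
  then have "eventually (\<lambda>z. F z = entire_xi z) (at s)"
    by eventually_elim (use eq in auto)
  moreover have "entire_xi \<midarrow>s\<rightarrow> entire_xi s"
    using holomorphic_on_imp_continuous_on[OF entire_xi_holomorphic, of UNIV]
    by (simp add: continuous_on_eq_continuous_at isCont_def)
  ultimately have "F \<midarrow>s\<rightarrow> entire_xi s"
    by (simp cong: tendsto_cong)
  then show "riemann_xi s = entire_xi s"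
    unfolding riemann_xi_def F_def by (rule remove_sings_eqI)
qed

subsection \<open>Growth of entire functions\<close>

text \<open>With \<open>B = A - Re (f w)\<close> and \<open>g\<close> the increment of
  \<open>f\<close>, the map \<open>g / (2 * B - g)\<close> takes the half-plane
  \<open>Re < B\<close> into the unit disc and fixes \<open>0\<close>; the Schwarz lemma applies,
  and one solves for \<open>g\<close>.\<close>

theorem Borel_Caratheodory:
  assumes holf: "f holomorphic_on ball w R"
    and Re_less: "\<And>z. z \<in> ball w R \<Longrightarrow> Re (f z) < A"
    and r: "0 \<le> r" "r < R" and z: "dist w z \<le> r"
  shows "norm (f z - f w) \<le> 2 * r / (R - r) * (A - Re (f w))"
proof -
  define B where "B = A - Re (f w)"
  have R: "R > 0" using r by simp
  have B: "B > 0" using Re_less[of w] R by (simp add: B_def)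
  define g where "g u = f (w + of_real R * u) - f w" for u
  have in_ball: "w + of_real R * u \<in> ball w R" if "norm u < 1" for u
    using that R by (simp add: dist_norm norm_mult)
  have Re_g: "Re (g u) < B" if "norm u < 1" for u
    using Re_less[OF in_ball[OF that]] by (simp add: g_def B_def)
  have hol_g: "g holomorphic_on ball 0 1"
  proof -
    have "(f \<circ> (\<lambda>u. w + of_real R * u)) holomorphic_on ball 0 1"
      by (rule holomorphic_on_compose_gen[OF _ holf]) (auto intro!: holomorphic_intros in_ball)
    then show ?thesis
      unfolding g_def o_def by (intro holomorphic_intros)
  qed
  have ne: "2 * of_real B - g u \<noteq> 0" if "norm u < 1" for u
    using Re_g[OF that] B by (auto simp: complex_eq_iff)
  \<comment> \<open>A value with real part below \<open>B\<close> is closer to \<open>0\<close> than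
    to the mirror image \<open>2 * B\<close>.\<close>
  have less: "norm (g u) < norm (2 * of_real B - g u)" if "norm u < 1" for u
  proof -
    have "(norm (2 * of_real B - g u))\<^sup>2 - (norm (g u))\<^sup>2 = 4 * B * (B - Re (g u))"
      unfolding cmod_power2 by (simp add: power2_eq_square algebra_simps)
    also have "\<dots> > 0" using Re_g[OF that] B by simp
    finally show ?thesis by (simp add: power2_less_imp_less)
  qed
  define h where "h u = g u / (2 * of_real B - g u)" for u
  have h_le: "norm (h u) \<le> norm u" if "norm u < 1" for u
  proof (rule Schwarz_Lemma(1))
    show "h holomorphic_on ball 0 1"
      unfolding h_def by (intro holomorphic_intros hol_g) (use ne in auto)
    show "norm (h u) < 1" if "norm u < 1" for u
    proof -
      have "0 < norm (2 * of_real B - g u)" using ne[OF that] by simp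
      then show ?thesis using less[OF that] by (simp add: h_def norm_divide)
    qed
  qed (use that in \<open>auto simp: h_def g_def\<close>)
  define u where "u = (z - w) / of_real R"
  have u: "norm u \<le> r / R" "r / R < 1"
    using z r R by (auto simp: u_def norm_divide dist_norm norm_minus_commute divide_right_mono)
  then have u1: "norm u < 1" by linarith
  have "g u = h u * (2 * of_real B - g u)" using ne[OF u1] by (simp add: h_def)
  then have "norm (g u) \<le> norm (h u) * norm (2 * of_real B - g u)"
    by (metis norm_mult order_refl)
  also have "\<dots> \<le> r / R * (2 * B + norm (g u))"
    using h_le[OF u1] u B norm_triangle_ineq4[of "2 * of_real B" "g u"] r R
    by (intro mult_mono) (auto simp: norm_mult)
  finally have "norm (g u) * (R - r) \<le> 2 * r * B"
    using R by (simp add: field_simps)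
  then have "norm (g u) \<le> 2 * r * B / (R - r)"
    using r by (simp add: field_simps)
  moreover have "g u = f z - f w" using R by (simp add: g_def u_def)
  ultimately show ?thesis by (simp add: B_def)
qed

text \<open>Gives the height at which the damping in the Phragmen-Lindelof argument beats the
  growth.\<close>

lemma power_over_exp_small:
  fixes k D :: real
  assumes "k > 0" "D > 0"
  shows "\<exists>Y\<ge>Y0. C * (1 + Y) ^ n \<le> D * exp (k * Y)"
proof -
  have "((\<lambda>Y. (k * (1 + Y)) ^ n / exp (k * (1 + Y))) \<longlongrightarrow> 0) at_top"
    by (rule filterlim_compose[OF tendsto_power_div_exp_0]) (use assms in real_asymp)
  then have "((\<lambda>Y. C / k ^ n * exp k * ((k * (1 + Y)) ^ n / exp (k * (1 + Y)))) \<longlongrightarrow> C / k ^ n * exp k * 0) at_top"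
    by (intro tendsto_intros)
  also have "(\<lambda>Y. C / k ^ n * exp k * ((k * (1 + Y)) ^ n / exp (k * (1 + Y)))) = (\<lambda>Y. C * (1 + Y) ^ n / exp (k * Y))"
  proof
    fix Y :: real
    have "(k * (1 + Y)) ^ n = k ^ n * (1 + Y) ^ n" "exp (k * (1 + Y)) = exp k * exp (k * Y)"
      by (simp only: power_mult_distrib, simp only: distrib_left mult_1_right exp_add)
    then show "C / k ^ n * exp k * ((k * (1 + Y)) ^ n / exp (k * (1 + Y))) = C * (1 + Y) ^ n / exp (k * Y)"
      using assms by simp
  qed
  finally have "eventually (\<lambda>Y. C * (1 + Y) ^ n / exp (k * Y) < D) at_top"
    using assms by (intro order_tendstoD(2)) auto
  then have "eventually (\<lambda>Y. Y \<ge> Y0 \<and> C * (1 + Y) ^ n / exp (k * Y) < D) at_top"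
    by (intro eventually_conj eventually_ge_at_top)
  then obtain Y where "Y \<ge> Y0" "C * (1 + Y) ^ n / exp (k * Y) < D"
    by (auto dest: eventually_happens)
  then show ?thesis by (intro exI[of _ Y]) (auto simp: field_simps)
qed

text \<open>\<open>f\<close> is damped by \<open>exp (- e * p)\<close>, where \<open>p\<close> is a
  cosine whose real part grows exponentially along the strip. The maximum principle on a tall
  rectangle bounds the product by \<open>1\<close>; then \<open>e\<close> tends to
  \<open>0\<close>.\<close>

theorem Phragmen_Lindelof_strip:
  assumes ab: "a < b"
    and holf: "f holomorphic_on {s. a < Re s \<and> Re s < b}"
    and contf: "continuous_on {s. a \<le> Re s \<and> Re s \<le> b} f"
    and edge: "\<And>s. Re s = a \<or> Re s = b \<Longrightarrow> norm (f s) \<le> 1"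
    and growth: "\<And>s. a \<le> Re s \<Longrightarrow> Re s \<le> b \<Longrightarrow> norm (f s) \<le> exp (C * (1 + \<bar>Im s\<bar>) ^ n)"
    and s: "a \<le> Re s" "Re s \<le> b"
  shows "norm (f s) \<le> 1"
proof -
  define m where "m = (a + b) / 2"
  \<comment> \<open>Keeps \<open>k * (x - m)\<close> within \<open>1 / 2\<close> of
    \<open>0\<close>, where the cosine has a positive lower bound.\<close>
  define k where "k = 1 / (b - a)"
  have k: "k > 0" using ab by (simp add: k_def)
  define p where "p z = cos (of_real k * (z - of_real m))" for z :: complex
  have half: "\<bar>k * (x - m)\<bar> \<le> 1 / 2" if "a \<le> x" "x \<le> b" for x
  proof -
    have "\<bar>x - m\<bar> \<le> (b - a) / 2"
      using that by (simp add: m_def abs_le_iff field_simps)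
    then show ?thesis using ab by (simp add: k_def field_simps)
  qed
  define c where "c = cos (1 / 2 :: real)"
  have c: "c > 0" unfolding c_def by (rule cos_gt_zero) (use pi_gt3 in auto)
  have Re_p: "Re (p z) \<ge> c / 2 * exp (k * \<bar>Im z\<bar>)" if "a \<le> Re z" "Re z \<le> b" for z
  proof -
    have "cos (1 / 2) \<le> cos \<bar>k * (Re z - m)\<bar>"
      by (rule cos_monotone_0_pi_le) (use half[OF that] pi_gt3 in auto)
    then have 1: "c \<le> cos (k * (Re z - m))" by (simp add: c_def)
    have 2: "exp (k * \<bar>Im z\<bar>) \<le> exp (k * Im z) + exp (- (k * Im z))"
      by (cases "Im z \<ge> 0") (auto simp: add_increasing add_increasing2)
    have "c * exp (k * \<bar>Im z\<bar>) \<le> cos (k * (Re z - m)) * (exp (k * Im z) + exp (- (k * Im z)))"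
      using 1 2 c by (intro mult_mono) auto
    then show ?thesis by (simp add: p_def Re_cos)
  qed
  have le: "norm (f s) \<le> exp (e * Re (p s))" if e: "e > 0" for e
  proof -
    \<comment> \<open>High enough for the damping on the horizontal edges and for \<open>s\<close>
      to lie in the rectangle.\<close>
    obtain Y where Y: "Y \<ge> 1 + \<bar>Im s\<bar>" "C * (1 + Y) ^ n \<le> e * (c / 2) * exp (k * Y)"
      using power_over_exp_small[of k "e * (c / 2)" "1 + \<bar>Im s\<bar>" C n] k e c by auto
    define S where "S = cbox (Complex a (- Y)) (Complex b Y)"
    have S: "z \<in> S \<longleftrightarrow> a \<le> Re z \<and> Re z \<le> b \<and> - Y \<le> Im z \<and> Im z \<le> Y" for z
      by (auto simp: S_def in_cbox_complex_iff)
    have intS: "interior S = box (Complex a (- Y)) (Complex b Y)"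
      by (simp add: S_def)
    define F where "F z = f z * exp (- of_real e * p z)" for z
    have p_hol: "p holomorphic_on A" for A
      unfolding p_def by (intro holomorphic_intros)
    have "norm (F s) \<le> 1"
    proof (rule maximum_modulus_frontier[of F S])
      show "F holomorphic_on interior S"
        unfolding F_def intS
        by (intro holomorphic_intros p_hol holomorphic_on_subset[OF holf]) (auto simp: in_box_complex_iff)
      have "continuous_on S F"
        unfolding F_def
        by (intro continuous_intros continuous_on_subset[OF contf] holomorphic_on_imp_continuous_on p_hol) (auto simp: S)
      then show "continuous_on (closure S) F" by (simp add: S_def)
      show "bounded S" by (simp add: S_def)
      show "s \<in> S" using s Y by (auto simp: S)
      fix z assume "z \<in> frontier S"
      then have zS: "z \<in> S" and nz: "z \<notin> interior S"
        by (auto simp: frontier_def S_def)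
      have nF: "norm (F z) = norm (f z) * exp (- e * Re (p z))"
        by (simp add: F_def norm_mult)
      show "norm (F z) \<le> 1"
      proof (cases "Re z = a \<or> Re z = b")
        case True
        have "Re (p z) \<ge> 0"
        proof (rule order_trans)
          show "c / 2 * exp (k * \<bar>Im z\<bar>) \<le> Re (p z)" using Re_p[of z] zS by (simp add: S)
        qed (use c in simp)
        then show ?thesis
          unfolding nF using edge[OF True] e by (intro mult_le_one) auto
      next
        case False
        then have Im: "\<bar>Im z\<bar> = Y"
          using nz zS Y by (auto simp: S intS in_box_complex_iff)
        have "norm (F z) \<le> exp (C * (1 + Y) ^ n) * exp (- e * (c / 2 * exp (k * Y)))"
          unfolding nF using growth[of z] Re_p[of z] zS e Im by (intro mult_mono) (auto simp: S)
        also have "\<dots> = exp (C * (1 + Y) ^ n - e * (c / 2) * exp (k * Y))"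
          by (simp flip: exp_add)
        also have "\<dots> \<le> 1" using Y(2) by simp
        finally show ?thesis .
      qed
    qed
    then have "norm (f s) * exp (- (e * Re (p s))) \<le> 1"
      by (simp add: F_def norm_mult)
    then show ?thesis
      by (simp add: exp_minus field_simps)
  qed
  have "((\<lambda>e. exp (e * Re (p s))) \<longlongrightarrow> exp (0 * Re (p s))) (at_right 0)"
    by (intro tendsto_intros)
  then have "((\<lambda>e. exp (e * Re (p s))) \<longlongrightarrow> 1) (at_right 0)" by simp
  moreover have "eventually (\<lambda>e. norm (f s) \<le> exp (e * Re (p s))) (at_right 0)"
    using le by (intro eventually_at_right_less[THEN eventually_mono]) auto
  ultimately show ?thesis
    by (intro tendsto_lowerbound[of _ 1 "at_right (0::real)"]) auto
qed

text \<open>Borel-Caratheodory for a logarithm \<open>g\<close> of \<open>f\<close>: the growth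
  bounds \<open>Re g\<close> above, and the lower bound at real points is carried over to
  \<open>s\<close>.\<close>

lemma half_plane_lower_bound:
  fixes f :: "complex \<Rightarrow> complex"
  assumes holf: "f holomorphic_on UNIV"
    and nz: "\<And>s. Re s > \<sigma> \<Longrightarrow> f s \<noteq> 0"
    and growth: "\<And>s. norm (f s) \<le> exp (C * (1 + norm s)\<^sup>2)"
    and real_lower: "\<And>r. r \<ge> 1 \<Longrightarrow> norm (f (of_real r)) \<ge> 1 / 2"
    and a: "\<sigma> < a"
  shows "\<exists>C'. \<forall>s. a \<le> Re s \<and> Re s \<le> b \<longrightarrow> norm (f s) \<ge> exp (- (C' * (1 + \<bar>Im s\<bar>) ^ 6))"
proof -
  define d where "d = (a - \<sigma>) / 2"
  have d: "d > 0" using a by (simp add: d_def)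
  obtain g where holg: "g holomorphic_on {s. Re s > \<sigma>}" and g: "\<And>s. Re s > \<sigma> \<Longrightarrow> exp (g s) = f s"
  proof (rule holomorphic_logarithm_exists[of "{s. Re s > \<sigma>}" f "of_real (\<sigma> + 1)"])
    show "convex {s. Re s > \<sigma>}" by (rule convex_halfspace_Re_gt)
    show "open {s. Re s > \<sigma>}" by (rule open_halfspace_Re_gt)
    show "f holomorphic_on {s. Re s > \<sigma>}" using holf by (rule holomorphic_on_subset) auto
  qed (use nz in auto)
  have Re_g: "Re (g s) = ln (norm (f s))" if "Re s > \<sigma>" for s
    using g[OF that] by (metis ln_exp norm_exp_eq_Re)
  \<comment> \<open>A negative \<open>C\<close> would push \<open>f\<close> below
    \<open>1 / 2\<close> far out on the real axis.\<close>
  have C: "C \<ge> 0"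
  proof -
    have *: "- ln 2 \<le> C * (1 + r)\<^sup>2" if "r \<ge> 1" for r
    proof -
      have "1 / 2 \<le> exp (C * (1 + r)\<^sup>2)"
        using real_lower[OF that] growth[of "of_real r"] that by simp
      then have "ln (1 / 2) \<le> ln (exp (C * (1 + r)\<^sup>2))" by (subst ln_le_cancel_iff) auto
      then show ?thesis by (simp add: ln_div)
    qed
    show ?thesis
    proof (rule ccontr)
      assume "\<not> C \<ge> 0"
      define r where "r = 1 + 1 / (- C)"
      have r: "r \<ge> 1" using \<open>\<not> C \<ge> 0\<close> by (simp add: r_def)
      have "(1 + r)\<^sup>2 \<ge> 1 / (- C)"
        using \<open>\<not> C \<ge> 0\<close> r self_le_power[of "1 + r" 2] by (simp add: r_def)
      then have "C * (1 + r)\<^sup>2 \<le> -1" using \<open>\<not> C \<ge> 0\<close> by (simp add: field_simps)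
      then show False using *[OF r] ln_2_less_1 by linarith
    qed
  qed
  \<comment> \<open>One constant for which \<open>W\<close>, \<open>R\<close> and \<open>r\<close>
    below are at most \<open>K * T\<close>, where \<open>T\<close> is
    \<open>(1 + \<bar>Im s\<bar>)\<^sup>2\<close>.\<close>
  define K where "K = 2 + \<bar>b\<bar> + 1 / d + \<bar>\<sigma>\<bar> + \<bar>a\<bar> + d"
  have K: "K \<ge> 0" using d by (simp add: K_def)
  define C' where "C' = 1 + 2 * K / d * (C * (1 + 2 * K)\<^sup>2 + 2)"
  show ?thesis
  proof (intro exI[of _ C'] allI impI)
    fix s assume s: "a \<le> Re s \<and> Re s \<le> b"
    define y where "y = Im s"
    define T where "T = (1 + \<bar>y\<bar>)\<^sup>2"
    have T1: "T \<ge> 1" by (simp add: T_def)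
    have yT: "y\<^sup>2 \<le> T" unfolding T_def by (simp add: abs_le_square_iff[symmetric])
    \<comment> \<open>A disc centred at a real point \<open>W\<close> of order \<open>y\<^sup>2\<close> and contained in the half-plane reaches \<open>s\<close>;
      so a lower bound for \<open>f\<close> on the real axis is enough.\<close>
    define W where "W = \<bar>b\<bar> + 1 + y\<^sup>2 / d"
    define R where "R = W - \<sigma>"
    define r where "r = W - a + d"
    have "y\<^sup>2 / d \<ge> 0" using d by simp
    then have Wb: "W \<ge> b + 1" "W \<ge> 1" unfolding W_def by linarith+
    have Rr: "R - r = d" by (simp add: R_def r_def d_def field_simps)
    have r0: "r \<ge> 0" using s Wb d by (simp add: r_def)
    have y_d: "y\<^sup>2 / d \<le> 1 / d * T" using yT d by (simp add: divide_right_mono)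
    have KT: "W \<le> K * T" "R \<le> K * T" "r \<le> K * T"
    proof -
      have m: "x \<le> x * T" if "x \<ge> 0" for x using that T1 by (simp add: mult_left_le mult_le_cancel_left1)
      have KTe: "K * T = 2 * T + \<bar>b\<bar> * T + 1 / d * T + \<bar>\<sigma>\<bar> * T + \<bar>a\<bar> * T + d * T"
        by (simp add: K_def algebra_simps)
      show "W \<le> K * T" "R \<le> K * T" "r \<le> K * T"
        unfolding KTe R_def r_def W_def
        using m[of "\<bar>b\<bar>"] m[of "\<bar>\<sigma>\<bar>"] m[of "\<bar>a\<bar>"] m[of d] d y_d T1 by linarith+
    qed
    have ball: "ball (of_real W) R \<subseteq> {s. Re s > \<sigma>}"
    proof
      fix z assume "z \<in> ball (complex_of_real W) R"
      then have "\<bar>Re (of_real W - z)\<bar> < R"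
        using abs_Re_le_cmod[of "of_real W - z"] by (simp add: dist_norm)
      then show "z \<in> {s. Re s > \<sigma>}" by (simp add: R_def)
    qed
    define A where "A = C * (1 + W + R)\<^sup>2 + 1"
    have W\<sigma>: "\<sigma> < W" using s a Wb by linarith
    have ReW: "Re (g (of_real W)) \<ge> - 1"
    proof -
      have "ln (1 / 2) \<le> ln (norm (f (of_real W)))"
        using real_lower[OF Wb(2)] by (intro ln_mono) auto
      then show ?thesis using Re_g[of "of_real W"] W\<sigma> ln_2_less_1 by (simp add: ln_div)
    qed
    have "norm (g s - g (of_real W)) \<le> 2 * r / (R - r) * (A - Re (g (of_real W)))"
    proof (rule Borel_Caratheodory[of g "of_real W" R])
      show "g holomorphic_on ball (of_real W) R"
        using holg ball by (rule holomorphic_on_subset)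
      show "0 \<le> r" "r < R" using r0 Rr d by auto
      \<comment> \<open>The summand \<open>y\<^sup>2 / d\<close> of \<open>W\<close> yields
        \<open>y\<^sup>2 \<le> d * (W - a)\<close>, which is absorbed by the mixed term of
        \<open>(W - a + d)\<^sup>2\<close>.\<close>
      show "dist (of_real W) s \<le> r"
      proof -
        have "(cmod (of_real W - s))\<^sup>2 = (W - Re s)\<^sup>2 + y\<^sup>2"
          unfolding cmod_power2 by (simp add: y_def)
        also have "(W - Re s)\<^sup>2 \<le> (W - a)\<^sup>2"
          using s Wb by (intro power_mono) auto
        also have "(W - a)\<^sup>2 + y\<^sup>2 \<le> (W - a)\<^sup>2 + 2 * d * (W - a) + d\<^sup>2"
        proof -
          have "y\<^sup>2 = d * (y\<^sup>2 / d)" using d by simp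
          also have "\<dots> \<le> d * (W - a)"
            using d s by (intro mult_left_mono) (auto simp: W_def)
          finally have "y\<^sup>2 \<le> d * (W - a)" .
          moreover have "0 \<le> d * (W - a)" using d s Wb by (intro mult_nonneg_nonneg) auto
          ultimately show ?thesis unfolding mult.assoc using zero_le_power2[of d] by linarith
        qed
        also have "\<dots> = r\<^sup>2" by (simp add: r_def power2_eq_square algebra_simps)
        finally have "(cmod (of_real W - s))\<^sup>2 \<le> r\<^sup>2" by simp
        then show ?thesis unfolding dist_norm using r0 by (rule power2_le_imp_le)
      qed
      fix z assume z: "z \<in> ball (complex_of_real W) R"
      then have "norm z \<le> W + R"
        using norm_triangle_ineq2[of z "of_real W"] Wb by (simp add: dist_norm norm_minus_commute)
      then have "C * (1 + norm z)\<^sup>2 \<le> C * (1 + W + R)\<^sup>2"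
        using C by (intro mult_left_mono power_mono) auto
      moreover have "Re (g z) \<le> C * (1 + norm z)\<^sup>2"
      proof -
        have "norm (f z) > 0" using nz z ball by auto
        then have "ln (norm (f z)) \<le> ln (exp (C * (1 + norm z)\<^sup>2))"
          using growth[of z] by (intro ln_mono) auto
        then show ?thesis using Re_g[of z] z ball by auto
      qed
      ultimately show "Re (g z) < A" by (simp add: A_def)
    qed
    \<comment> \<open>The factor \<open>r / d\<close> contributes \<open>T\<close> and the growth
      bound \<open>A\<close> contributes \<open>T\<^sup>2\<close>; the cube of \<open>T\<close> is
      the sixth power in the claim.\<close>
    also have "\<dots> \<le> 2 * (K * T) / d * ((C * (1 + 2 * K)\<^sup>2 + 2) * T\<^sup>2)"
      unfolding Rr
    proof (intro mult_mono divide_right_mono)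
      have "1 + W + R \<le> (1 + 2 * K) * T" using KT T1 by (simp add: algebra_simps)
      then have "(1 + W + R)\<^sup>2 \<le> ((1 + 2 * K) * T)\<^sup>2"
        using Wb W\<sigma> by (intro power_mono) (auto simp: R_def)
      then have "C * (1 + W + R)\<^sup>2 \<le> C * ((1 + 2 * K)\<^sup>2 * T\<^sup>2)"
        using C by (intro mult_left_mono) (auto simp: power_mult_distrib)
      moreover have "2 \<le> 2 * T\<^sup>2" using T1 by simp
      ultimately show "A - Re (g (of_real W)) \<le> (C * (1 + 2 * K)\<^sup>2 + 2) * T\<^sup>2"
        unfolding A_def distrib_right mult.assoc using ReW by linarith
      show "0 \<le> A - Re (g (of_real W))"
      proof -
        have "norm (f (of_real W)) \<le> exp (C * (1 + W)\<^sup>2)"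
          using growth[of "of_real W"] Wb by simp
        moreover have "norm (f (of_real W)) > 0" using real_lower[OF Wb(2)] by linarith
        ultimately have "Re (g (of_real W)) \<le> C * (1 + W)\<^sup>2"
          using Re_g[of "of_real W"] W\<sigma> by (metis Re_complex_of_real exp_gt_zero ln_exp ln_le_cancel_iff)
        also have "\<dots> \<le> C * (1 + W + R)\<^sup>2"
          using C Wb W\<sigma> by (intro mult_left_mono power_mono) (auto simp: R_def)
        finally show ?thesis by (simp add: A_def)
      qed
    qed (use KT d K T1 r0 in auto)
    also have "\<dots> = (2 * K / d * (C * (1 + 2 * K)\<^sup>2 + 2)) * T ^ 3"
      by (simp add: power2_eq_square power3_eq_cube)
    finally have "Re (g s) \<ge> Re (g (of_real W)) - (2 * K / d * (C * (1 + 2 * K)\<^sup>2 + 2)) * T ^ 3"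
      using abs_Re_le_cmod[of "g s - g (of_real W)"] by (simp add: abs_le_iff)
    moreover have "1 \<le> T ^ 3" using T1 by (rule one_le_power)
    ultimately have "Re (g s) \<ge> - (C' * T ^ 3)"
      unfolding C'_def distrib_right using ReW by linarith
    then have "exp (- (C' * T ^ 3)) \<le> norm (f s)"
      using g[of s] s a by (metis exp_le_cancel_iff norm_exp_eq_Re order_less_le_trans)
    then show "norm (f s) \<ge> exp (- (C' * (1 + \<bar>Im s\<bar>) ^ 6))"
      by (simp add: T_def y_def flip: power_mult)
  qed
qed

text \<open>A simple case of Hadamard factorisation: a logarithm of \<open>f\<close> grows more
  slowly than \<open>(norm z)\<^sup>2\<close>, so it is affine, and evenness kills its linear
  part.\<close>

lemma even_zero_free_imp_constant:
  fixes f :: "complex \<Rightarrow> complex"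
  assumes holf: "f holomorphic_on UNIV" and nz: "\<And>z. f z \<noteq> 0"
    and even: "\<And>z. f (- z) = f z"
    and growth: "\<And>z. norm (f z) \<le> exp (C * (1 + norm z) powr (3 / 2))"
  shows "f z = f 0"
proof -
  obtain g where holg: "g holomorphic_on UNIV" and g: "\<And>z. exp (g z) = f z"
    using holomorphic_logarithm_exists[of UNIV f 0] holf nz by auto
  define h where "h z = g z - g 0" for z
  have holh: "h holomorphic_on A" for A
    unfolding h_def by (intro holomorphic_intros holomorphic_on_subset[OF holg]) auto
  define c where "c = deriv h 0"
  have Re_g: "Re (g z) \<le> C * (1 + norm z) powr (3 / 2)" for z
    using growth[of z] unfolding g[of z, symmetric] by simp
  have h_bound: "norm (h z) \<le> 2 * (\<bar>C\<bar> * (1 + 2 * r) powr (3 / 2) + 1 - Re (g 0))" if "norm z \<le> r" "r > 0" for z r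
  proof -
    have "norm (g z - g 0) \<le> 2 * r / (2 * r - r) * ((\<bar>C\<bar> * (1 + 2 * r) powr (3 / 2) + 1) - Re (g 0))"
    proof (rule Borel_Caratheodory[of g 0 "2 * r"])
      show "g holomorphic_on ball 0 (2 * r)" using holg by (rule holomorphic_on_subset) auto
      fix u assume "u \<in> ball (0::complex) (2 * r)"
      then have "(1 + norm u) powr (3 / 2) \<le> (1 + 2 * r) powr (3 / 2)"
        by (intro powr_mono2) auto
      then have "C * (1 + norm u) powr (3 / 2) \<le> \<bar>C\<bar> * (1 + 2 * r) powr (3 / 2)"
        by (intro mult_mono) auto
      then show "Re (g u) < \<bar>C\<bar> * (1 + 2 * r) powr (3 / 2) + 1"
        using Re_g[of u] by linarith
    qed (use that in auto)
    then show ?thesis using that by (simp add: h_def)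
  qed
  \<comment> \<open>By Cauchy's inequality on large circles, since
    \<open>r powr (3 / 2) / r ^ 2\<close> tends to \<open>0\<close>.\<close>
  have higher: "(deriv ^^ n) h 0 = 0" if n: "n \<ge> 2" for n
  proof -
    have bound: "norm ((deriv ^^ n) h 0) \<le> fact n * (2 * (\<bar>C\<bar> * (1 + 2 * r) powr (3 / 2) + 1 - Re (g 0))) / r ^ 2" if r: "r \<ge> 1" for r
    proof -
      have "norm ((deriv ^^ n) h 0) \<le> fact n * (2 * (\<bar>C\<bar> * (1 + 2 * r) powr (3 / 2) + 1 - Re (g 0))) / r ^ n"
        by (rule Cauchy_inequality) (use holh r h_bound[of _ r] in \<open>auto intro: holomorphic_on_imp_continuous_on\<close>)
      also have "\<dots> \<le> fact n * (2 * (\<bar>C\<bar> * (1 + 2 * r) powr (3 / 2) + 1 - Re (g 0))) / r ^ 2"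
        using r n norm_ge_zero[THEN order_trans, OF h_bound[of 0 r]]
        by (intro divide_left_mono mult_nonneg_nonneg) (auto intro: power_increasing)
      finally show ?thesis .
    qed
    have "((\<lambda>r. fact n * (2 * (\<bar>C\<bar> * (1 + 2 * r) powr (3 / 2) + 1 - Re (g 0))) / r ^ 2) \<longlongrightarrow> 0) at_top"
    proof -
      have "((\<lambda>r::real. (1 + 2 * r) powr (3 / 2) / r ^ 2) \<longlongrightarrow> 0) at_top" "((\<lambda>r::real. 1 / r ^ 2) \<longlongrightarrow> 0) at_top"
        by real_asymp+
      then have "((\<lambda>r. (2 * fact n * \<bar>C\<bar>) * ((1 + 2 * r) powr (3 / 2) / r ^ 2) + (2 * fact n * (1 - Re (g 0))) * (1 / r ^ 2))
          \<longlongrightarrow> (2 * fact n * \<bar>C\<bar>) * 0 + (2 * fact n * (1 - Re (g 0))) * 0) at_top"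
        by (intro tendsto_intros)
      then show ?thesis by (simp add: field_simps add_divide_distrib diff_divide_distrib)
    qed
    moreover have "eventually (\<lambda>r. norm ((deriv ^^ n) h 0) \<le> fact n * (2 * (\<bar>C\<bar> * (1 + 2 * r) powr (3 / 2) + 1 - Re (g 0))) / r ^ 2) at_top"
      using eventually_ge_at_top[of 1] by eventually_elim (rule bound)
    ultimately have "norm ((deriv ^^ n) h 0) \<le> 0"
      by (intro tendsto_lowerbound) auto
    then show ?thesis by simp
  qed
  have h: "h z = c * z" for z
  proof (rule holomorphic_fun_eq_on_connected[of h UNIV "\<lambda>z. c * z" 0])
    show "(deriv ^^ n) h 0 = (deriv ^^ n) ((*) c) 0" for n
    proof (cases "n \<ge> 2")
      case False
      then have "n = 0 \<or> n = 1" by auto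
      then show ?thesis by (auto simp: c_def h_def)
    qed (simp add: higher)
  qed (auto intro!: holh holomorphic_intros)
  have f: "f z = f 0 * exp (c * z)" for z
    using h[of z] by (simp add: h_def g[symmetric] algebra_simps flip: exp_add)
  have "c = 0"
  proof (rule ccontr)
    \<comment> \<open>At \<open>1 / c\<close> evenness would give
      \<open>exp 1 = exp (- 1)\<close>.\<close>
    assume "c \<noteq> 0"
    then have "exp (1::complex) = exp (- 1)"
      using even[of "1 / c"] nz[of 0] by (simp add: f[of "1 / c"] f[of "- (1 / c)"])
    then have "norm (exp (1::complex)) = norm (exp (- 1 :: complex))" by simp
    then show False by simp
  qed
  then show ?thesis using f[of z] by simp
qed

subsection \<open>Growth of the xi function\<close>

lemma inverse_squares_Suc_sums: "(\<lambda>n. 1 / real (Suc n) powr 2) sums (pi\<^sup>2 / 6)"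
  using inverse_squares_sums by (simp add: add_ac)

text \<open>Comparison with the full Mellin integral at \<open>2 * m\<close>, where Gamma is a
  factorial, the power of \<open>pi\<close> is at most \<open>1\<close> and the Dirichlet series is
  at most the sum of inverse squares.\<close>

lemma norm_half_mellin_le_fact:
  assumes m: "m \<ge> 2" and s: "Re s \<le> 2 * real m"
  shows "norm (half_mellin s) \<le> fact (m - 1) * (pi\<^sup>2 / 6)"
proof -
  define r where "r = complex_of_real (2 * real m)"
  have r: "Re r > 1" using m by (simp add: r_def)
  have G: "Gamma (r / 2) = fact (m - 1)"
    using Gamma_fact[of "m - 1", where 'a = complex] m by (simp add: r_def)
  have P: "norm (complex_of_real pi powr (- r / 2)) \<le> 1"
    using m pi_gt3 by (simp add: r_def powr_minus_divide norm_divide norm_power)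
  have le: "norm (of_real pi powr (- r / 2) * Gamma (r / 2) * (1 / of_nat (Suc n) powr r)) \<le>
      fact (m - 1) * (1 / real (Suc n) powr 2)" for n
  proof -
    have "norm (of_real pi powr (- r / 2) * Gamma (r / 2) * (1 / of_nat (Suc n) powr r)) =
        norm (complex_of_real pi powr (- r / 2)) * fact (m - 1) * (1 / real (Suc n) powr (2 * real m))"
      unfolding norm_mult norm_divide norm_one cmod_of_nat_Suc_powr G by (simp add: r_def)
    also have "\<dots> \<le> 1 * fact (m - 1) * (1 / real (Suc n) powr 2)"
      using P m by (intro mult_mono frac_le powr_mono) auto
    finally show ?thesis by simp
  qed
  have "norm (half_mellin s) \<le> Re (LINT v|lborel. exp (of_real (2 * real m) * of_real v) * of_real (theta_kernel v))"
    by (rule norm_half_mellin_le) (use m s in auto)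
  also have "\<dots> \<le> norm (LINT v|lborel. exp (r * of_real v) * of_real (theta_kernel v))"
    unfolding r_def by (rule complex_Re_le_cmod)
  also have "\<dots> = norm (\<Sum>n. of_real pi powr (- r / 2) * Gamma (r / 2) * (1 / of_nat (Suc n) powr r))"
    by (simp only: sums_unique[OF mellin_theta_sums[OF r]])
  also have "\<dots> \<le> (\<Sum>n. fact (m - 1) * (1 / real (Suc n) powr 2))"
    using le sums_summable[OF inverse_squares_Suc_sums] by (intro norm_suminf_le summable_mult) auto
  also have "\<dots> = fact (m - 1) * (pi\<^sup>2 / 6)"
    using sums_mult[OF inverse_squares_Suc_sums, of "fact (m - 1)"] by (rule sums_unique[symmetric])
  finally show ?thesis .
qed

text \<open>From \<open>fact m \<le> m ^ m\<close> and \<open>ln m \<le> 2 * sqrt m\<close>. The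
  exponent stays below \<open>2\<close>, as the argument on zero-free functions demands.\<close>

lemma fact_le_exp_powr:
  fixes m :: nat
  assumes "m \<ge> 1"
  shows "fact m \<le> exp (2 * real m powr (3 / 2))"
proof -
  have "ln (real m) = 2 * ln (sqrt (real m))"
    using assms by (simp add: ln_sqrt)
  also have "\<dots> \<le> 2 * sqrt (real m)"
    using assms by (intro mult_left_mono ln_bound) auto
  finally have "real m * ln (real m) \<le> real m * (2 * sqrt (real m))"
    by (intro mult_left_mono) auto
  also have "\<dots> = 2 * real m powr (3 / 2)"
  proof -
    have "real m powr (3 / 2) = real m powr 1 * real m powr (1 / 2)"
      by (subst powr_add[symmetric]) simp
    then show ?thesis using assms by (simp add: powr_half_sqrt)
  qed
  finally have "real m * ln (real m) \<le> 2 * real m powr (3 / 2)" .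
  moreover have "real (fact m) \<le> real m ^ m"
    using fact_le_power[of m] by (simp flip: of_nat_power add: le_refl)
  moreover have "real m ^ m = exp (real m * ln (real m))"
    using assms by (simp add: exp_of_nat_mult)
  ultimately show ?thesis
    by (metis exp_le_cancel_iff of_nat_fact order_trans)
qed

lemma entire_xi_growth:
  obtains C where "C \<ge> 0" "\<And>s. norm (entire_xi s) \<le> exp (C * (1 + norm s) powr (3 / 2))"
proof
  define S where "S = pi\<^sup>2 / 6"
  have S: "S \<ge> 0" by (simp add: S_def)
  \<comment> \<open>\<open>18 = 2 * 3\<^sup>2\<close> comes from the factorial with
    \<open>m \<le> 3 * u\<close>, \<open>2\<close> from the quadratic factor, \<open>S\<close> from
    the inverse squares, and \<open>1\<close> absorbs the summand \<open>1 / 2\<close>.\<close>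
  show "21 + S \<ge> 0" using S by simp
  fix s :: complex
  define u where "u = 1 + norm s"
  define T where "T = u powr (3 / 2)"
  \<comment> \<open>Chosen so that \<open>2 * m\<close> is at least \<open>norm s + 1\<close>, which
    bounds the real parts of \<open>s\<close> and \<open>1 - s\<close>.\<close>
  define m where "m = nat \<lceil>norm s\<rceil> + 2"
  have u: "u \<ge> 1" by (simp add: u_def)
  have uT: "u \<le> T"
    using powr_mono[of 1 "3/2" u] u by (simp add: T_def)
  have m: "m \<ge> 2" by (simp add: m_def)
  obtain q where "real m = q + 2" "q - 1 < norm s" "norm s \<le> q"
    using ceiling_correct[of "norm s"] that[of "of_int \<lceil>norm s\<rceil>"] by (simp add: m_def)
  then have m1: "real m \<le> 3 * u" "norm s + 1 \<le> 2 * real m"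
    unfolding u_def using norm_ge_zero[of s] by argo+
  have h: "norm (half_mellin z) \<le> exp (18 * T) * S" if "Re z \<le> norm s + 1" for z
  proof -
    have "norm (half_mellin z) \<le> fact (m - 1) * S"
      unfolding S_def using m that m1 by (intro norm_half_mellin_le_fact) auto
    also have "fact (m - 1) \<le> (fact m :: real)" by (rule fact_mono) simp
    also have "\<dots> \<le> exp (2 * real m powr (3 / 2))"
      using m by (intro fact_le_exp_powr) simp
    also have "real m powr (3 / 2) \<le> (3 * u) powr (3 / 2)"
      using m1 by (intro powr_mono2) auto
    also have "\<dots> = 3 powr (3 / 2) * T"
      using u by (simp add: T_def powr_mult)
    also have "3 powr (3 / 2) \<le> (3 powr 2 :: real)" by (rule powr_mono) auto
    also have "(3 powr 2 :: real) = 9" by simp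
    finally show ?thesis using S u by (simp add: mult_right_mono T_def)
  qed
  have "norm (entire_xi s) \<le> 1 / 2 + norm (s * (s - 1) / 2 * (half_mellin s + half_mellin (1 - s)))"
    unfolding entire_xi_def using norm_triangle_ineq[of "1 / 2" "s * (s - 1) / 2 * (half_mellin s + half_mellin (1 - s))"] by simp
  also have "norm (s * (s - 1) / 2 * (half_mellin s + half_mellin (1 - s))) \<le>
      u * u / 2 * (exp (18 * T) * S + exp (18 * T) * S)"
  proof -
    have "norm (s * (s - 1) / 2) \<le> u * u / 2"
      unfolding norm_mult norm_divide u_def
      using norm_triangle_ineq4[of s 1] by (intro divide_mono mult_mono) auto
    moreover have "norm (half_mellin s + half_mellin (1 - s)) \<le> exp (18 * T) * S + exp (18 * T) * S"
      using abs_Re_le_cmod[of s] by (intro norm_triangle_mono h) auto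
    ultimately show ?thesis
      unfolding norm_mult[of "s * (s - 1) / 2"] using u by (intro mult_mono) auto
  qed
  also have "\<dots> = u * u * exp (18 * T) * S" by simp
  also have "\<dots> \<le> exp T * exp T * exp (18 * T) * exp (S * T)"
  proof (intro mult_mono)
    have "T \<le> exp T" using exp_ge_add_one_self[of T] by linarith
    then show "u \<le> exp T" using uT by linarith
    then show "u \<le> exp T" .
    have "S \<le> S * T" using S u uT by (simp add: mult_le_cancel_left1)
    then show "S \<le> exp (S * T)" using exp_ge_add_one_self[of "S * T"] by linarith
  qed (use u S in auto)
  also have "\<dots> = exp ((20 + S) * T)"
    by (simp add: algebra_simps flip: exp_add)
  also have "1 / 2 + exp ((20 + S) * T) \<le> exp ((20 + S) * T) * exp T"
  proof -
    have "1 \<le> exp ((20 + S) * T)" using S u uT by simp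
    moreover have "2 \<le> exp T" using exp_ge_add_one_self[of T] u uT by linarith
    then have "exp ((20 + S) * T) * 2 \<le> exp ((20 + S) * T) * exp T" by simp
    ultimately show ?thesis by linarith
  qed
  also have "\<dots> = exp ((21 + S) * (1 + norm s) powr (3 / 2))"
    by (simp add: T_def u_def algebra_simps flip: exp_add)
  finally show "norm (entire_xi s) \<le> exp ((21 + S) * (1 + norm s) powr (3 / 2))" by simp
qed

text \<open>Factor by factor, with \<open>v = w - h + n\<close>:
  \<open>norm (v + h) / norm v\<close> is at most \<open>1 + h / norm v\<close>, hence at most
  \<open>1 + h / Re v\<close>.\<close>

lemma norm_pochhammer_ratio:
  assumes "0 < h" "h < Re w"
  shows "norm (pochhammer w n) * pochhammer (Re w - h) n \<le> norm (pochhammer (w - of_real h) n) * pochhammer (Re w) n"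
proof (induction n)
  case (Suc n)
  define v where "v = w - of_real h + of_nat n"
  have v: "Re v > 0" "Re v \<le> norm v" using assms complex_Re_le_cmod[of v] by (auto simp: v_def)
  have "norm (v + of_real h) \<le> norm v + h"
    using norm_triangle_ineq[of v "of_real h"] assms by simp
  then have "norm (v + of_real h) * Re v \<le> (norm v + h) * Re v"
    using v by (intro mult_right_mono) auto
  also have "\<dots> \<le> norm v * (Re v + h)"
    using v assms by (simp add: algebra_simps mult_left_mono)
  finally have *: "norm (w + of_nat n) * (Re w - h + real n) \<le> norm (w - of_real h + of_nat n) * (Re w + real n)"
    by (simp add: v_def)
  have "(norm (pochhammer w n) * pochhammer (Re w - h) n) * (norm (w + of_nat n) * (Re w - h + real n)) \<le>
      (norm (pochhammer (w - of_real h) n) * pochhammer (Re w) n) * (norm (w - of_real h + of_nat n) * (Re w + real n))"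
    using assms by (intro mult_mono Suc * mult_nonneg_nonneg pochhammer_nonneg) auto
  then show ?case by (simp add: pochhammer_Suc norm_mult mult_ac)
qed simp

text \<open>The Pochhammer inequality passes to the limit of \<open>Gamma_series\<close>: on a
  vertical line the quotient of shifted and unshifted Gamma is largest, in absolute value, at the
  real point.\<close>

lemma norm_Gamma_shift_le:
  assumes h: "0 < h" "h < Re w"
  shows "norm (Gamma (w - of_real h)) \<le> Gamma (Re w - h) / Gamma (Re w) * norm (Gamma w)"
proof -
  define x where "x = Re w"
  have le: "norm (Gamma_series (w - of_real h) n) * Gamma_series x n \<le> Gamma_series (x - h) n * norm (Gamma_series w n)" for n
  proof -
    have p: "pochhammer (x - h) (n + 1) > 0" "pochhammer x (n + 1) > 0"
      using h by (auto simp: x_def intro!: pochhammer_pos)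
    have nz: "pochhammer w (n + 1) \<noteq> 0" "pochhammer (w - of_real h) (n + 1) \<noteq> 0"
      using h by (auto simp: pochhammer_eq_0_iff dest!: arg_cong[where f = Re])
    define E where "E = fact n * exp ((x - h) * ln n) * (fact n * exp (x * ln n))"
    have "norm (Gamma_series (w - of_real h) n) * Gamma_series x n = E / (norm (pochhammer (w - of_real h) (n + 1)) * pochhammer x (n + 1))"
      by (simp add: Gamma_series_def norm_mult norm_divide E_def x_def)
    also have "\<dots> \<le> E / (norm (pochhammer w (n + 1)) * pochhammer (x - h) (n + 1))"
      using p nz norm_pochhammer_ratio[OF h, of "n + 1"]
      by (intro divide_left_mono mult_pos_pos) (auto simp: E_def x_def)
    also have "\<dots> = Gamma_series (x - h) n * norm (Gamma_series w n)"
      by (simp add: Gamma_series_def norm_mult norm_divide E_def x_def)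
    finally show ?thesis .
  qed
  have "norm (Gamma (w - of_real h)) * Gamma x \<le> Gamma (x - h) * norm (Gamma w)"
    by (rule LIMSEQ_le[of "\<lambda>n. norm (Gamma_series (w - of_real h) n) * Gamma_series x n" _
          "\<lambda>n. Gamma_series (x - h) n * norm (Gamma_series w n)"])
       (auto intro!: tendsto_intros Gamma_series_LIMSEQ le)
  moreover have "Gamma x > 0" using h by (intro Gamma_real_pos) (simp add: x_def)
  ultimately show ?thesis by (simp add: x_def field_simps)
qed

text \<open>Dividing the limits of \<open>Gamma_series\<close> at \<open>1 + h\<close> and
  \<open>1\<close> shows that \<open>Gamma (n + 2) / Gamma (n + 2 + h)\<close> is asymptotic to
  \<open>n powr (- h)\<close>; so \<open>x = n + 2 + h\<close> works for large
  \<open>n\<close>.\<close>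

lemma Gamma_shift_ratio_small:
  fixes h e X :: real
  assumes h: "h > 0" and e: "e > 0"
  shows "\<exists>x>X. x > h \<and> Gamma (x - h) / Gamma x < e"
proof -
  define f where "f z n = Gamma_series z n / Gamma z" for z :: real and n
  have f: "f z \<longlonglongrightarrow> 1" if "z > 0" for z
    using tendsto_divide[OF Gamma_series_LIMSEQ[of z] tendsto_const[of "Gamma z"]] Gamma_real_pos[OF that]
    by (simp add: f_def[abs_def])
  have f_eq: "f z n = fact n * exp (z * ln n) / Gamma (z + real n + 1)" if "z > 0" for z n
  proof -
    have "z \<notin> \<int>\<^sub>\<le>\<^sub>0" using that by (auto elim!: nonpos_Ints_cases)
    then show ?thesis
      using Gamma_real_pos[OF that] pochhammer_Gamma[of z "n + 1"] by (simp add: f_def Gamma_series_def add_ac)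
  qed
  have "(\<lambda>n. exp (- h * ln (real n)) * (f (1 + h) n / f 1 n)) \<longlonglongrightarrow> 0 * (1 / 1)"
  proof (intro tendsto_mult tendsto_divide f)
    show "(\<lambda>n. exp (- h * ln (real n))) \<longlonglongrightarrow> 0" using h by real_asymp
  qed (use h in auto)
  moreover have "exp (- h * ln (real n)) * (f (1 + h) n / f 1 n) = Gamma (1 + real n + 1) / Gamma (1 + h + real n + 1)" for n
    using h unfolding f_eq[of "1 + h", OF add_pos_pos[OF zero_less_one h]] f_eq[of 1, OF zero_less_one]
    by (simp add: distrib_right exp_add exp_minus divide_simps)
  ultimately have "(\<lambda>n. Gamma (1 + real n + 1) / Gamma (1 + h + real n + 1)) \<longlonglongrightarrow> 0" by simp
  then have "eventually (\<lambda>n. Gamma (1 + real n + 1) / Gamma (1 + h + real n + 1) < e) sequentially"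
    using e by (rule order_tendstoD)
  moreover have "eventually (\<lambda>n. 1 + h + real n + 1 > X) sequentially"
    by real_asymp
  ultimately have "eventually (\<lambda>n. Gamma (1 + real n + 1) / Gamma (1 + h + real n + 1) < e \<and> 1 + h + real n + 1 > X) sequentially"
    by (rule eventually_conj)
  then obtain n where "Gamma (1 + real n + 1) / Gamma (1 + h + real n + 1) < e" "1 + h + real n + 1 > X"
    by (auto dest: eventually_happens)
  then show ?thesis
    by (intro exI[of _ "1 + h + real n + 1"]) (simp add: algebra_simps)
qed

subsection \<open>Monotonicity\<close>

text \<open>Comparison with the inverse squares. For \<open>Re s \<ge> 3\<close> every term after
  the first is at most half an inverse square, so \<open>pi < 4\<close> bounds the tail by
  \<open>5 / 6\<close> against the leading \<open>1\<close>.\<close>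

lemma
  assumes sums: "(\<lambda>n. 1 / of_nat (Suc n) powr s) sums Z"
  shows norm_Dirichlet_le: "Re s \<ge> 2 \<Longrightarrow> norm Z \<le> pi\<^sup>2 / 6"
    and norm_Dirichlet_ge: "Re s \<ge> 3 \<Longrightarrow> norm Z \<ge> 1 / 6"
proof -
  have norm_eq: "norm (1 / of_nat (Suc n) powr s) = 1 / real (Suc n) powr Re s" for n
    by (simp only: norm_divide norm_one cmod_of_nat_Suc_powr)
  show "norm Z \<le> pi\<^sup>2 / 6" if s: "Re s \<ge> 2"
  proof -
    have "norm (1 / of_nat (Suc n) powr s) \<le> 1 / real (Suc n) powr 2" for n
      unfolding norm_eq using s by (intro divide_left_mono powr_mono mult_pos_pos) auto
    then have "norm (\<Sum>n. 1 / of_nat (Suc n) powr s) \<le> (\<Sum>n. 1 / real (Suc n) powr 2)"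
      by (intro norm_suminf_le sums_summable[OF inverse_squares_Suc_sums])
    then show ?thesis
      using sums inverse_squares_Suc_sums by (simp only: sums_iff)
  qed
  show "norm Z \<ge> 1 / 6" if s: "Re s \<ge> 3"
  proof -
    have "(\<lambda>n. 1 / of_nat (Suc (Suc n)) powr s) sums (Z - 1)"
      using sums_split_initial_segment[OF sums, of 1] by simp
    then have Z: "Z - 1 = (\<Sum>n. 1 / of_nat (Suc (Suc n)) powr s)"
      by (rule sums_unique)
    have tail: "(\<lambda>n. 1 / 2 * (1 / real (Suc (Suc n)) powr 2)) sums (1 / 2 * (pi\<^sup>2 / 6 - 1))"
      using sums_split_initial_segment[OF inverse_squares_Suc_sums, of 1] by (intro sums_mult) simp
    have "norm (1 / of_nat (Suc (Suc n)) powr s) \<le> 1 / 2 * (1 / real (Suc (Suc n)) powr 2)" for n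
    proof -
      have "2 * real (Suc (Suc n)) powr 2 \<le> real (Suc (Suc n)) powr 1 * real (Suc (Suc n)) powr 2"
        by (intro mult_right_mono) auto
      also have "\<dots> = real (Suc (Suc n)) powr 3" by (subst powr_add[symmetric]) simp
      also have "\<dots> \<le> real (Suc (Suc n)) powr Re s" using s by (intro powr_mono) auto
      finally have "1 / real (Suc (Suc n)) powr Re s \<le> 1 / (2 * real (Suc (Suc n)) powr 2)"
        by (intro divide_left_mono mult_pos_pos) auto
      then show ?thesis unfolding norm_eq by simp
    qed
    then have "norm (Z - 1) \<le> 1 / 2 * (pi\<^sup>2 / 6 - 1)"
      unfolding Z sums_unique[OF tail] by (intro norm_suminf_le sums_summable[OF tail])
    also have "\<dots> \<le> 5 / 6"
    proof -
      have "pi\<^sup>2 \<le> 4\<^sup>2" using pi_less_4 by (intro power_mono) auto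
      then show ?thesis by simp
    qed
    finally show ?thesis using norm_triangle_ineq2[of 1 "1 - Z"] by (simp add: norm_minus_commute)
  qed
qed

text \<open>In the product formula, far to the right, the shift shrinks the polynomial factors,
  costs bounded factors in the power of \<open>pi\<close> and the Dirichlet series, and makes the
  Gamma quotient as small as desired.\<close>

lemma entire_xi_shift_small:
  assumes c: "c > 0"
  shows "\<exists>B>X. \<forall>s. Re s = B \<longrightarrow> norm (entire_xi (s - of_real c)) \<le> 1 / 2 * norm (entire_xi s)"
proof -
  define P where "P = pi powr (c / 2)"
  have P: "P > 0" by (simp add: P_def)
  \<comment> \<open>Leaves \<open>1 / 2\<close> after the losses \<open>P\<close> from the power of
    \<open>pi\<close> and \<open>pi\<^sup>2\<close> from the Dirichlet series.\<close>
  define e where "e = 1 / (2 * pi\<^sup>2 * P)"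
  have e: "e > 0" using P by (simp add: e_def)
  obtain x where x: "x > \<bar>X\<bar> + c + 3" "x > c / 2" "Gamma (x - c / 2) / Gamma x < e"
    using Gamma_shift_ratio_small[of "c / 2" e "\<bar>X\<bar> + c + 3"] c e by auto
  show ?thesis
  proof (intro exI[of _ "2 * x"] conjI allI impI)
    show "2 * x > X" using x c by linarith
    fix s assume s: "Re s = 2 * x"
    define Z where "Z z = (\<Sum>n. 1 / complex_of_nat (Suc n) powr z)" for z
    have Z: "(\<lambda>n. 1 / of_nat (Suc n) powr z) sums Z z" if "Re z > 1" for z
    proof -
      have "summable (\<lambda>n. norm (1 / complex_of_nat (Suc n) powr z))"
        using summable_Suc_powr[OF that] by (simp only: norm_divide norm_one cmod_of_nat_Suc_powr)
      then show ?thesis unfolding Z_def by (rule summable_sums[OF summable_norm_cancel])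
    qed
    have xi: "entire_xi z = 1 / 2 * z * (z - 1) * of_real pi powr (- z / 2) * Gamma (z / 2) * Z z" if "Re z > 1" for z
      using entire_xi_sums[OF that] sums_mult[OF Z[OF that]] by (rule sums_unique2)
    define w where "w = s - of_real c"
    have Re_w: "Re w = 2 * x - c" "Re w > 2" "Re s > 3" using s x c by (auto simp: w_def)
    \<comment> \<open>Applied with \<open>d = 0\<close> and \<open>d = 1\<close>, for the factors
      \<open>s\<close> and \<open>s - 1\<close>.\<close>
    have less: "norm (s - of_real c - of_real d) \<le> norm (s - of_real d)" if "0 \<le> d" "d \<le> 1" for d
    proof -
      have "(Re s - c - d)\<^sup>2 \<le> (Re s - d)\<^sup>2" using that c Re_w s x by (intro power_mono) auto
      then show ?thesis by (simp add: cmod_def)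
    qed
    have 1: "norm w \<le> norm s" "norm (w - 1) \<le> norm (s - 1)"
      using less[of 0] less[of 1] by (auto simp: w_def)
    have 2: "norm (complex_of_real pi powr (- w / 2)) = P * norm (complex_of_real pi powr (- s / 2))"
    proof -
      have "Re (- w / 2) = c / 2 + Re (- s / 2)" by (simp add: w_def field_simps)
      moreover have "norm (complex_of_real pi powr z) = pi powr Re z" for z
        by (simp add: norm_powr_real_powr)
      ultimately show ?thesis by (simp only: P_def powr_add)
    qed
    have 3: "norm (Gamma (w / 2)) \<le> e * norm (Gamma (s / 2))"
    proof -
      have "norm (Gamma (s / 2 - of_real (c / 2))) \<le> Gamma (Re (s / 2) - c / 2) / Gamma (Re (s / 2)) * norm (Gamma (s / 2))"
        by (rule norm_Gamma_shift_le) (use c x s in auto)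
      also have "\<dots> \<le> e * norm (Gamma (s / 2))"
        using x(3) s by (intro mult_right_mono) auto
      finally show ?thesis by (simp add: w_def diff_divide_distrib)
    qed
    have 4: "norm (Z w) \<le> pi\<^sup>2 * norm (Z s)"
    proof -
      have "norm (Z w) \<le> pi\<^sup>2 / 6"
        using Re_w by (intro norm_Dirichlet_le[OF Z]) auto
      moreover have "norm (Z s) \<ge> 1 / 6"
        using Re_w by (intro norm_Dirichlet_ge[OF Z]) auto
      then have "pi\<^sup>2 * (1 / 6) \<le> pi\<^sup>2 * norm (Z s)" by (rule mult_left_mono) simp
      ultimately show ?thesis by argo
    qed
    have "norm (entire_xi w) = 1 / 2 * norm w * norm (w - 1) * norm (complex_of_real pi powr (- w / 2)) * norm (Gamma (w / 2)) * norm (Z w)"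
      using Re_w by (subst xi) (auto simp: norm_mult norm_divide)
    also have "\<dots> \<le> 1 / 2 * norm s * norm (s - 1) * (P * norm (complex_of_real pi powr (- s / 2))) * (e * norm (Gamma (s / 2))) * (pi\<^sup>2 * norm (Z s))"
      unfolding 2 using 1 3 4 P e by (intro mult_mono) auto
    also have "\<dots> = (P * e * pi\<^sup>2) * norm (entire_xi s)"
      using Re_w by (subst xi) (auto simp: norm_mult norm_divide)
    also have "P * e * pi\<^sup>2 = 1 / 2" using P by (simp add: e_def)
    finally show "norm (entire_xi (s - of_real c)) \<le> 1 / 2 * norm (entire_xi s)" by (simp add: w_def)
  qed
qed

text \<open>Without zeros, the function recentred at \<open>1 / 2\<close> would be even and of order
  below two, hence constant, but a nonzero constant is not halved by a shift.\<close>

lemma entire_xi_has_zero: "\<exists>s. entire_xi s = 0"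
proof (rule ccontr)
  assume "\<nexists>s. entire_xi s = 0"
  then have nz: "entire_xi s \<noteq> 0" for s by blast
  define f where "f z = entire_xi (1 / 2 + z)" for z
  obtain C where C: "C \<ge> 0" "\<And>s. norm (entire_xi s) \<le> exp (C * (1 + norm s) powr (3 / 2))"
    by (rule entire_xi_growth) blast
  have const: "f z = f 0" for z
  proof (rule even_zero_free_imp_constant)
    have "(entire_xi \<circ> (\<lambda>z. 1 / 2 + z)) holomorphic_on UNIV"
      by (rule holomorphic_on_compose[OF _ entire_xi_holomorphic]) (intro holomorphic_intros)
    then show "f holomorphic_on UNIV" by (simp add: f_def[abs_def] o_def)
    show "f z \<noteq> 0" for z by (simp add: f_def nz)
    show "f (- z) = f z" for z
      using entire_xi_reflect[of "1 / 2 + z"] by (simp add: f_def)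
    show "norm (f z) \<le> exp (C * 2 powr (3 / 2) * (1 + norm z) powr (3 / 2))" for z
    proof -
      have "norm (1 / 2 + z) \<le> 1 / 2 + norm z"
        using norm_triangle_ineq[of "1 / 2" z] by simp
      then have "1 + norm (1 / 2 + z) \<le> 2 * (1 + norm z)"
        using norm_ge_zero[of z] by argo
      then have "(1 + norm (1 / 2 + z)) powr (3 / 2) \<le> (2 * (1 + norm z)) powr (3 / 2)"
        by (intro powr_mono2) auto
      also have "\<dots> = 2 powr (3 / 2) * (1 + norm z) powr (3 / 2)"
        by (rule powr_mult)
      finally have "C * (1 + norm (1 / 2 + z)) powr (3 / 2) \<le> C * (2 powr (3 / 2) * (1 + norm z) powr (3 / 2))"
        using C(1) by (rule mult_left_mono)
      then show ?thesis
        unfolding f_def mult.assoc using C(2)[of "1 / 2 + z"] by (meson exp_le_cancel_iff order_trans)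
    qed
  qed
  then have same: "entire_xi s = entire_xi t" for s t
    using const[of "s - 1 / 2"] const[of "t - 1 / 2"] by (simp add: f_def)
  obtain B where "\<And>s. Re s = B \<Longrightarrow> norm (entire_xi (s - of_real 1)) \<le> 1 / 2 * norm (entire_xi s)"
    using entire_xi_shift_small[of 1 0] by auto
  from this[of "of_real B"] show False
    using same[of "of_real B - of_real 1" "of_real B"] nz by simp
qed

theorem entire_xi_strict_mono:
  assumes nz: "\<And>s. Re s > \<sigma> \<Longrightarrow> entire_xi s \<noteq> 0"
    and less: "\<sigma> < x1" "x1 < x2"
  shows "norm (entire_xi (Complex x1 t)) < norm (entire_xi (Complex x2 t))"
proof -
  \<comment> \<open>A zero \<open>\<rho>\<close> comes with the zero \<open>1 - \<rho>\<close>; both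
    lie in \<open>Re s \<le> \<sigma>\<close>, and their real parts add up to
    \<open>1\<close>.\<close>
  have \<sigma>: "\<sigma> \<ge> 1 / 2"
  proof -
    obtain \<rho> where "entire_xi \<rho> = 0" using entire_xi_has_zero by blast
    then have "Re \<rho> \<le> \<sigma>" "Re (1 - \<rho>) \<le> \<sigma>"
      using nz[of \<rho>] nz[of "1 - \<rho>"] entire_xi_reflect[of \<rho>] by force+
    then show ?thesis by simp
  qed
  define a where "a = (x1 + x2) / 2"
  define c where "c = 2 * a - 1"
  have a: "\<sigma> < a" "a < x2" using less by (auto simp: a_def)
  have c: "c > 0" using a \<sigma> by (simp add: c_def)
  define Q where "Q s = entire_xi (s - of_real c) / entire_xi s" for s
  obtain C where C: "C \<ge> 0" "\<And>s. norm (entire_xi s) \<le> exp (C * (1 + norm s) powr (3 / 2))"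
    by (rule entire_xi_growth) blast
  have growth: "norm (entire_xi s) \<le> exp (C * (1 + norm s)\<^sup>2)" for s
  proof -
    have "(1 + norm s) powr (3 / 2) \<le> (1 + norm s) powr 2" by (rule powr_mono) auto
    also have "\<dots> = (1 + norm s)\<^sup>2" by (simp add: powr_numeral add_nonneg_eq_0_iff)
    finally have "C * (1 + norm s) powr (3 / 2) \<le> C * (1 + norm s)\<^sup>2" using C(1) by (rule mult_left_mono)
    then show ?thesis using C(2)[of s] by (meson exp_le_cancel_iff order_trans)
  qed
  have Q_hol: "Q holomorphic_on {s. Re s > \<sigma>}"
  proof -
    have "(entire_xi \<circ> (\<lambda>s. s - of_real c)) holomorphic_on {s. Re s > \<sigma>}"
      by (rule holomorphic_on_compose[OF _ entire_xi_holomorphic]) (intro holomorphic_intros)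
    then show ?thesis
      unfolding Q_def o_def by (intro holomorphic_intros entire_xi_holomorphic) (use nz in auto)
  qed
  \<comment> \<open>Up to conjugation, \<open>s - c\<close> is \<open>1\<close> minus the mirror image of \<open>s\<close> in the line \<open>Re s = a\<close>;
    so the functional equation makes \<open>Q\<close> unimodular on that line.\<close>
  have refl: "norm (entire_xi (s - of_real c)) = norm (entire_xi (Complex (2 * a - Re s) (Im s)))" for s
  proof -
    have "s - of_real c = 1 - cnj (Complex (2 * a - Re s) (Im s))"
      by (simp add: complex_eq_iff c_def)
    then show ?thesis by (simp only: entire_xi_reflect entire_xi_cnj complex_mod_cnj)
  qed
  have Q_a: "norm (Q s) = 1" if "Re s = a" for s
  proof -
    have "Complex (2 * a - Re s) (Im s) = s" using that by (simp add: complex_eq_iff)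
    then show ?thesis using refl[of s] nz[of s] that a by (simp add: Q_def norm_divide)
  qed
  have Q_B: "\<exists>B>X. \<forall>s. Re s = B \<longrightarrow> norm (Q s) \<le> 1 / 2" for X
  proof -
    \<comment> \<open>The maximum with \<open>\<sigma>\<close> keeps the line where the denominator
      of \<open>Q\<close> has no zeros.\<close>
    obtain B where B: "B > max X \<sigma>" "\<And>s. Re s = B \<Longrightarrow> norm (entire_xi (s - of_real c)) \<le> 1 / 2 * norm (entire_xi s)"
      using entire_xi_shift_small[OF c, of "max X \<sigma>"] by blast
    have "norm (Q s) \<le> 1 / 2" if "Re s = B" for s
      using B(2)[OF that] nz[of s] that B(1) by (simp add: Q_def norm_divide divide_le_eq)
    then show ?thesis using B(1) by auto
  qed
  have Q_le: "norm (Q s) \<le> 1" if s: "Re s \<ge> a" for s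
  proof -
    obtain B where B: "B > Re s" "\<And>s. Re s = B \<Longrightarrow> norm (Q s) \<le> 1 / 2"
      using Q_B[of "Re s"] by blast
    obtain C1 where C1: "\<And>s. a \<le> Re s \<and> Re s \<le> B \<Longrightarrow> norm (entire_xi s) \<ge> exp (- (C1 * (1 + \<bar>Im s\<bar>) ^ 6))"
      using half_plane_lower_bound[OF entire_xi_holomorphic nz growth entire_xi_of_real_ge a(1), of B] by blast
    \<comment> \<open>Chosen so that
      \<open>1 + norm (z - c) \<le> K * (1 + \<bar>Im z\<bar>)\<close> in the whole strip.\<close>
    define K where "K = 1 + \<bar>a\<bar> + \<bar>B\<bar> + c"
    have K: "K \<ge> 1" using c by (simp add: K_def)
    show ?thesis
    proof (rule Phragmen_Lindelof_strip[of a B Q])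
      show "a < B" using s B by linarith
      show "Q holomorphic_on {s. a < Re s \<and> Re s < B}"
        by (rule holomorphic_on_subset[OF Q_hol]) (use a in auto)
      show "continuous_on {s. a \<le> Re s \<and> Re s \<le> B} Q"
        by (rule continuous_on_subset[OF holomorphic_on_imp_continuous_on[OF Q_hol]]) (use a in auto)
      show "norm (Q z) \<le> 1" if "Re z = a \<or> Re z = B" for z
        using that Q_a[of z] B(2)[of z] by auto
      show "norm (Q z) \<le> exp ((C * K\<^sup>2 + C1) * (1 + \<bar>Im z\<bar>) ^ 6)" if z: "a \<le> Re z" "Re z \<le> B" for z
      proof -
        define y where "y = 1 + \<bar>Im z\<bar>"
        have y: "y \<ge> 1" by (simp add: y_def)
        have "1 + norm (z - of_real c) \<le> K * y"
        proof -
          have "norm (z - of_real c) \<le> \<bar>Re z - c\<bar> + \<bar>Im z\<bar>"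
            using cmod_le[of "z - of_real c"] by simp
          then have "1 + norm (z - of_real c) \<le> K + \<bar>Im z\<bar>"
            using z c by (simp add: K_def abs_le_iff)
          also have "\<dots> \<le> K + K * \<bar>Im z\<bar>" using K by (simp add: mult_le_cancel_right1)
          finally show ?thesis by (simp add: y_def distrib_left)
        qed
        then have "(1 + norm (z - of_real c))\<^sup>2 \<le> (K * y)\<^sup>2" by (intro power_mono) auto
        also have "\<dots> = K\<^sup>2 * y\<^sup>2" by (rule power_mult_distrib)
        also have "\<dots> \<le> K\<^sup>2 * y ^ 6" using y by (intro mult_left_mono power_increasing) auto
        finally have "C * (1 + norm (z - of_real c))\<^sup>2 \<le> C * (K\<^sup>2 * y ^ 6)"
          using C(1) by (rule mult_left_mono)
        then have 1: "norm (entire_xi (z - of_real c)) \<le> exp (C * (K\<^sup>2 * y ^ 6))"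
          using growth[of "z - of_real c"] by (meson exp_le_cancel_iff order_trans)
        have 2: "exp (- (C1 * y ^ 6)) \<le> norm (entire_xi z)"
          using C1[of z] z by (simp add: y_def)
        have "norm (Q z) \<le> exp (C * (K\<^sup>2 * y ^ 6)) / exp (- (C1 * y ^ 6))"
          unfolding Q_def norm_divide using 1 2 by (intro frac_le) auto
        also have "\<dots> = exp ((C * K\<^sup>2 + C1) * y ^ 6)"
          by (simp add: exp_minus distrib_right exp_add mult.assoc divide_inverse)
        finally show ?thesis by (simp add: y_def)
      qed
    qed (use s B in auto)
  qed
  \<comment> \<open>By the maximum principle, equality at one point makes \<open>Q\<close> constant,
    but \<open>Q\<close> is at most \<open>1 / 2\<close> in absolute value on some line in the
    half-plane.\<close>
  have strict: "norm (Q s) < 1" if s: "Re s > a" for s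
  proof (rule ccontr)
    assume "\<not> norm (Q s) < 1"
    then have eq: "norm (Q s) = 1" using Q_le[of s] s by linarith
    have "Q constant_on {s. Re s > a}"
    proof (rule maximum_modulus_principle[of Q _ "{s. Re s > a}" s])
      show "Q holomorphic_on {s. Re s > a}"
        by (rule holomorphic_on_subset[OF Q_hol]) (use a in auto)
      show "connected {s. Re s > a}" by (intro convex_connected convex_halfspace_Re_gt)
      show "norm (Q z) \<le> norm (Q s)" if "z \<in> {s. Re s > a}" for z
        using Q_le[of z] that eq by simp
    qed (use s open_halfspace_Re_gt in auto)
    then obtain k where k: "\<And>z. Re z > a \<Longrightarrow> Q z = k" by (auto simp: constant_on_def)
    obtain B where "B > a" "\<And>s. Re s = B \<Longrightarrow> norm (Q s) \<le> 1 / 2" using Q_B[of a] by blast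
    from this(2)[of "of_real B"] this(1) show False
      using k[of "of_real B"] k[OF s] eq by simp
  qed
  have "norm (Q (Complex x2 t)) < 1" by (rule strict) (use a in simp)
  then have "norm (entire_xi (Complex x2 t - of_real c)) < norm (entire_xi (Complex x2 t))"
    using nz[of "Complex x2 t"] less by (simp add: Q_def norm_divide)
  \<comment> \<open>The point \<open>x1\<close> is the mirror image of \<open>x2\<close> in the
    midpoint \<open>a\<close>.\<close>
  moreover have "Complex (2 * a - Re (Complex x2 t)) (Im (Complex x2 t)) = Complex x1 t"
    by (simp add: a_def field_simps)
  ultimately show ?thesis using refl[of "Complex x2 t"] by simp
qed

theorem theorem1:
  fixes \<sigma>\<^sub>0 :: real
  shows "({s. Re s > \<sigma>\<^sub>0} \<inter> {s. riemann_xi s = 0} = {} \<longrightarrow>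
           (\<forall>t\<^sub>0 :: real. strict_mono_on {\<sigma>\<^sub>0<..} (\<lambda>\<sigma>. cmod (riemann_xi (Complex \<sigma> t\<^sub>0))))) \<and>
         ({s. Re s < \<sigma>\<^sub>0} \<inter> {s. riemann_xi s = 0} = {} \<longrightarrow>
           (\<forall>t\<^sub>0 :: real. strict_antimono_on {..<\<sigma>\<^sub>0} (\<lambda>\<sigma>. cmod (riemann_xi (Complex \<sigma> t\<^sub>0)))))"
proof (intro conjI impI allI)
  fix t\<^sub>0 :: real
  assume "{s. Re s > \<sigma>\<^sub>0} \<inter> {s. riemann_xi s = 0} = {}"
  then have "entire_xi s \<noteq> 0" if "Re s > \<sigma>\<^sub>0" for s
    using that by (auto simp: riemann_xi_eq)
  then show "strict_mono_on {\<sigma>\<^sub>0<..} (\<lambda>\<sigma>. cmod (riemann_xi (Complex \<sigma> t\<^sub>0)))"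
    unfolding riemann_xi_eq by (intro strict_mono_onI entire_xi_strict_mono) auto
next
  fix t\<^sub>0 :: real
  assume "{s. Re s < \<sigma>\<^sub>0} \<inter> {s. riemann_xi s = 0} = {}"
  then have nz: "entire_xi s \<noteq> 0" if "Re s < \<sigma>\<^sub>0" for s
    using that by (auto simp: riemann_xi_eq)
  \<comment> \<open>\<open>s \<mapsto> 1 - s\<close> carries the left half-plane to
    \<open>Re s > 1 - \<sigma>\<^sub>0\<close>.\<close>
  have nz': "entire_xi s \<noteq> 0" if "Re s > 1 - \<sigma>\<^sub>0" for s
    using nz[of "1 - s"] that by (simp add: entire_xi_reflect)
  \<comment> \<open>The reflection reverses the order of the real parts, so increase becomes
    decrease.\<close>
  have "norm (entire_xi (Complex x2 t\<^sub>0)) < norm (entire_xi (Complex x1 t\<^sub>0))" if "x1 < x2" "x2 < \<sigma>\<^sub>0" for x1 x2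
  proof -
    have "norm (entire_xi (Complex (1 - x2) (- t\<^sub>0))) < norm (entire_xi (Complex (1 - x1) (- t\<^sub>0)))"
      by (rule entire_xi_strict_mono[OF nz']) (use that in auto)
    moreover have "entire_xi (Complex (1 - x) (- t\<^sub>0)) = entire_xi (Complex x t\<^sub>0)" for x
    proof -
      have "Complex (1 - x) (- t\<^sub>0) = 1 - Complex x t\<^sub>0" by (simp add: complex_eq_iff)
      then show ?thesis by (simp only: entire_xi_reflect)
    qed
    ultimately show ?thesis by simp
  qed
  then show "strict_antimono_on {..<\<sigma>\<^sub>0} (\<lambda>\<sigma>. cmod (riemann_xi (Complex \<sigma> t\<^sub>0)))"
    unfolding riemann_xi_eq by (intro monotone_onI) auto
qed

end
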